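(* Fix a positive integer $k$. For each positive integer $i$ let $w_i=\lim_{n\to\infty}W_{n,i}$ (these limits exist) and let $w=\sum_{i=1}^\infty w_i$ (this series converges). Then the limit $a_k:=\lim_{n\to\infty}a_{n,k}$ exists, and $a_k=w$.
   Context: A labeled non-plane 1-2 tree on vertex set $[n]=\{1,\dots,n\}$ is a rooted tree whose vertices are bijectively labeled by $[n]$, in which every vertex has at most two children, the label of each non-root vertex is less than the label of its parent, and the children of a vertex are unordered. The rank of a vertex $v$ is the number of edges in a shortest path from $v$ to a leaf that is a descendant of $v$ (leaves have rank $0$). The subtree of $v$ consists of $v$ and all its descendants; its size is its number of vertices. Choose a pair $(T,v)$ uniformly at random among all pairs with $T$ such a tree on $[n]$ and $v$ a vertex of $T$. Then $a_{n,k}$ is the probability that $v$ has rank $k$, and $W_{n,i}$ is the probability that $v$ has rank $k$ and its subtree has size exactly $i$. *)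

theory Defs
  imports "HOL-Probability.Probability_Mass_Function"
begin

text \<open>A rooted tree is given by its vertex set \<open>V\<close>, its root \<open>r\<close> and the set \<open>E\<close> of pairs
  (child, parent). Being a set, \<open>E\<close> puts no order on the children of a vertex.\<close>

definition rooted_tree :: "'a set \<Rightarrow> 'a \<Rightarrow> ('a \<times> 'a) set \<Rightarrow> bool" where
  "rooted_tree V r E \<longleftrightarrow>
     r \<in> V \<and> E \<subseteq> V \<times> V \<and>
     (\<forall>p. (r, p) \<notin> E) \<and>
     (\<forall>v\<in>V - {r}. \<exists>!p. (v, p) \<in> E) \<and>
     (\<forall>v\<in>V. (v, r) \<in> E\<^sup>*)"

definition children :: "('a \<times> 'a) set \<Rightarrow> 'a \<Rightarrow> 'a set" where
  "children E v = {c. (c, v) \<in> E}"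

definition is_leaf :: "('a \<times> 'a) set \<Rightarrow> 'a \<Rightarrow> bool" where
  "is_leaf E v \<longleftrightarrow> children E v = {}"

text \<open>\<open>(l, v) \<in> E ^^ d\<close> says that \<open>l\<close> is a descendant of \<open>v\<close>, joined to it by a path
  with \<open>d\<close> edges.\<close>

definition vertex_rank :: "('a \<times> 'a) set \<Rightarrow> 'a \<Rightarrow> nat" where
  "vertex_rank E v = (LEAST d. \<exists>l. is_leaf E l \<and> (l, v) \<in> E ^^ d)"

definition subtree_vertices :: "('a \<times> 'a) set \<Rightarrow> 'a \<Rightarrow> 'a set" where
  "subtree_vertices E v = {u. (u, v) \<in> E\<^sup>*}"

text \<open>Labeled non-plane 1-2 trees on \<open>{1..n}\<close>; the vertices are the labels themselves.\<close>

definition trees12 :: "nat \<Rightarrow> (nat \<times> nat) set set" where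
  "trees12 n = {E. (\<exists>r. rooted_tree {1..n} r E) \<and>
     (\<forall>v\<in>{1..n}. card (children E v) \<le> 2) \<and>
     (\<forall>(c, p)\<in>E. c < p)}"

definition tree_vertex_pairs :: "nat \<Rightarrow> ((nat \<times> nat) set \<times> nat) set" where
  "tree_vertex_pairs n = trees12 n \<times> {1..n}"

text \<open>\<open>pmf_of_set\<close> is the uniform distribution only on a finite nonempty set.\<close>

lemma finite_tree_vertex_pairs: "finite (tree_vertex_pairs n)"
proof -
  have "trees12 n \<subseteq> Pow ({1..n} \<times> {1..n})"
    by (auto simp: trees12_def rooted_tree_def)
  then have "finite (trees12 n)"
    by (rule finite_subset) simp
  then show ?thesis
    by (simp add: tree_vertex_pairs_def)
qed

lemma tree_vertex_pairs_nonempty: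
  assumes "n \<ge> 1"
  shows "tree_vertex_pairs n \<noteq> {}"
proof -
  define E where "E = {(i, Suc i) | i. 1 \<le> i \<and> i < n}"
  have reach: "(v, n) \<in> E\<^sup>*" if "1 \<le> v" "v \<le> n" for v
    using that(2,1)
  proof (induction v rule: inc_induct)
    case base
    then show ?case by simp
  next
    case (step m)
    then have "(m, Suc m) \<in> E" by (auto simp: E_def)
    then show ?case using step by (meson converse_rtrancl_into_rtrancl le_SucI)
  qed
  have "rooted_tree {1..n} n E"
    using assms reach by (auto simp: rooted_tree_def E_def)
  moreover have "card (children E v) \<le> 2" for v
  proof -
    have "children E v \<subseteq> {v - 1}" by (auto simp: children_def E_def)
    then have "card (children E v) \<le> card {v - 1}" by (intro card_mono) auto
    then show ?thesis by simp
  qed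
  ultimately have "E \<in> trees12 n"
    by (auto simp: trees12_def E_def)
  then show ?thesis
    using assms by (auto simp: tree_vertex_pairs_def)
qed

definition rank_prob :: "nat \<Rightarrow> nat \<Rightarrow> real" where
  "rank_prob k n =
     measure_pmf.prob (pmf_of_set (tree_vertex_pairs n)) {(T, v). vertex_rank T v = k}"

definition rank_size_prob :: "nat \<Rightarrow> nat \<Rightarrow> nat \<Rightarrow> real" where
  "rank_size_prob k n i =
     measure_pmf.prob (pmf_of_set (tree_vertex_pairs n))
       {(T, v). vertex_rank T v = k \<and> card (subtree_vertices T v) = i}"

definition limit_rank_size_prob :: "nat \<Rightarrow> nat \<Rightarrow> real" where
  "limit_rank_size_prob k i = lim (\<lambda>n. rank_size_prob k n i)"

end

theory Submission
  imports Defs "HOL-Complex_Analysis.Complex_Analysis" "HOL-Real_Asymp.Real_Asymp"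
begin

text \<open>Deleting the root \<open>n\<close> splits a tree into a subtree
  containing \<open>n - 1\<close> and a possibly empty rest. With \<open>y = sec x + tan x\<close>, the exponential
  generating function of the trees, this yields \<open>P = r (y' G)\<close> for the one of the pairs \<open>(T, v)\<close> in
  which the subtree of \<open>v\<close> has size \<open>i\<close> and rank \<open>k\<close>. Here \<open>y' = 1 / (1 - sin x)\<close>,
  \<open>G' = (1 - sin x) x^(i-1) / (i-1)!\<close>, and the rank enters only through the number \<open>r\<close> of trees of size
  \<open>i\<close> with root rank \<open>k\<close>. Since \<open>y\<close> has a single pole, simple and at \<open>\<pi>/2\<close>, in the disc of
  radius \<open>3\<pi>/2\<close>, its coefficients are asymptotic to \<open>2 (2/\<pi>)^(n+1)\<close>, so \<open>W_{n,i}\<close> tends to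
  \<open>r (2/\<pi>) G (\<pi>/2)\<close>. If \<open>r\<close> is replaced by the number of all trees of size \<open>i\<close>, these limits
  add up to \<open>1\<close>. Hence the size distributions of a random subtree lose no mass in the limit, and as
  they dominate \<open>W_{n,i}\<close>, limit and sum may be exchanged.\<close>

subsection \<open>Increasing trees and relabelling\<close>

definition inc_trees :: "nat set \<Rightarrow> (nat \<times> nat) set set" where
  "inc_trees V = {E. E \<subseteq> V \<times> V \<and> (\<forall>(c, p)\<in>E. c < p) \<and>
     (\<forall>v\<in>V - {Max V}. \<exists>!p. (v, p) \<in> E) \<and> (\<forall>v\<in>V. card (children E v) \<le> 2)}"

lemma inc_treesI:
  assumes "E \<subseteq> V \<times> V" "\<And>c p. (c, p) \<in> E \<Longrightarrow> c < p"
    "\<And>v. v \<in> V \<Longrightarrow> v \<noteq> Max V \<Longrightarrow> \<exists>!p. (v, p) \<in> E"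
    "\<And>v. v \<in> V \<Longrightarrow> card (children E v) \<le> 2"
  shows "E \<in> inc_trees V"
  using assms by (auto simp: inc_trees_def)

lemma inc_treesD:
  assumes "E \<in> inc_trees V"
  shows "E \<subseteq> V \<times> V" "\<And>c p. (c, p) \<in> E \<Longrightarrow> c < p"
    "\<And>v. v \<in> V \<Longrightarrow> v \<noteq> Max V \<Longrightarrow> \<exists>!p. (v, p) \<in> E"
    "\<And>v. v \<in> V \<Longrightarrow> card (children E v) \<le> 2"
  using assms by (auto simp: inc_trees_def)

lemma finite_inc_trees: "finite V \<Longrightarrow> finite (inc_trees V)"
  by (rule finite_subset[of _ "Pow (V \<times> V)"]) (auto simp: inc_trees_def)

lemma inc_trees_Max_no_parent:
  assumes "finite V" "E \<in> inc_trees V"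
  shows "(Max V, p) \<notin> E"
proof
  assume "(Max V, p) \<in> E"
  then have "p \<in> V" "Max V < p" using inc_treesD(1,2)[OF assms(2)] by auto
  then show False using assms(1) Max_ge[of V p] by linarith
qed

lemma inc_trees_parent_unique:
  assumes "finite V" "E \<in> inc_trees V" "(v, p) \<in> E" "(v, q) \<in> E"
  shows "p = q"
proof -
  have "v \<in> V" "v \<noteq> Max V"
    using inc_treesD(1)[OF assms(2)] assms inc_trees_Max_no_parent[OF assms(1,2)] by auto
  then show ?thesis using inc_treesD(3)[OF assms(2)] assms(3,4) by blast
qed

text \<open>Climbing to a parent raises the label, and labels are bounded by \<open>Max V\<close>;
  the induction is on the remaining gap.\<close>

lemma inc_trees_reach_Max:
  assumes "finite V" "E \<in> inc_trees V" "v \<in> V"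
  shows "(v, Max V) \<in> E\<^sup>*"
  using assms(3)
proof (induction "Max V - v" arbitrary: v rule: less_induct)
  case less
  show ?case
  proof (cases "v = Max V")
    case False
    then obtain p where p: "(v, p) \<in> E" using inc_treesD(3)[OF assms(2)] less.prems by blast
    have "p \<in> V" "v < p" using p inc_treesD(1,2)[OF assms(2)] by auto
    moreover have "p \<le> Max V" using \<open>p \<in> V\<close> assms(1) by simp
    ultimately have "(p, Max V) \<in> E\<^sup>*" by (intro less.hyps) auto
    then show ?thesis using p by (meson converse_rtrancl_into_rtrancl)
  qed simp
qed

lemma trees12_eq_inc_trees:
  assumes "n \<ge> 1"
  shows "trees12 n = inc_trees {1..n}"
proof (intro equalityI subsetI)
  have Mx: "Max {1..n} = n" using assms by (intro Max_eqI) auto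
  {
    fix E assume "E \<in> trees12 n"
    then obtain r where r: "rooted_tree {1..n} r E"
      and ch: "\<forall>v\<in>{1..n}. card (children E v) \<le> 2" and lt: "\<forall>(c, p)\<in>E. c < p"
      by (auto simp: trees12_def)
    \<comment> \<open>The vertex \<open>n\<close> can have no parent, since no label exceeds it, so
      it must be the root.\<close>
    have "r = n"
    proof (rule ccontr)
      assume "r \<noteq> n"
      moreover have "n \<in> {1..n}" using assms by simp
      ultimately have "\<exists>!p. (n, p) \<in> E" using r unfolding rooted_tree_def by blast
      then obtain p where "(n, p) \<in> E" by blast
      then have "p \<in> {1..n}" "n < p" using r lt by (auto simp: rooted_tree_def)
      then show False by simp
    qed
    then show "E \<in> inc_trees {1..n}"
      using r ch lt unfolding inc_trees_def rooted_tree_def Mx by simp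
  next
    fix E assume E: "E \<in> inc_trees {1..n}"
    have "rooted_tree {1..n} n E"
      unfolding rooted_tree_def
    proof (intro conjI ballI allI)
      show "n \<in> {1..n}" using assms by simp
      show "E \<subseteq> {1..n} \<times> {1..n}" by (rule inc_treesD(1)[OF E])
      show "(n, p) \<notin> E" for p
        using inc_trees_Max_no_parent[OF _ E] Mx by simp
      show "\<exists>!p. (v, p) \<in> E" if "v \<in> {1..n} - {n}" for v
        using inc_treesD(3)[OF E, of v] that Mx by simp
      show "(v, n) \<in> E\<^sup>*" if "v \<in> {1..n}" for v
        using inc_trees_reach_Max[OF _ E that] Mx by simp
    qed
    moreover have "\<forall>(c, p)\<in>E. c < p" using inc_treesD(2)[OF E] by blast
    ultimately show "E \<in> trees12 n"
      using inc_treesD(4)[OF E] unfolding trees12_def by blast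
  }
qed

lemma inc_trees_empty: "inc_trees {} = {{}}"
  by (auto simp: inc_trees_def)

lemma inc_trees_singleton: "inc_trees {m} = {{}}"
  by (auto simp: inc_trees_def children_def)

lemma children_finite: "E \<subseteq> V \<times> V \<Longrightarrow> finite V \<Longrightarrow> finite (children E v)"
  by (rule finite_subset[of _ V]) (auto simp: children_def)

text \<open>Ranks are prescribed by a set \<open>K\<close>: a singleton gives the rank of interest,
  while \<open>UNIV\<close> gives the size distribution of all subtrees, and both obey the same
  recurrences.\<close>

definition count_vertices :: "nat set \<Rightarrow> nat \<Rightarrow> nat set \<Rightarrow> (nat \<times> nat) set \<Rightarrow> nat" where
  "count_vertices K i V E = card {v \<in> V. vertex_rank E v \<in> K \<and> card (subtree_vertices E v) = i}"

text \<open>The Euler zigzag numbers 1, 1, 1, 2, 5, ...; the value at 0 counts the empty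
  tree.\<close>

definition tree_count :: "nat \<Rightarrow> nat" where
  "tree_count n = card (inc_trees {..<n})"

definition root_rank_count :: "nat set \<Rightarrow> nat \<Rightarrow> nat" where
  "root_rank_count K n = card {E \<in> inc_trees {..<n}. vertex_rank E (Max {..<n}) \<in> K}"

definition pair_count :: "nat set \<Rightarrow> nat \<Rightarrow> nat \<Rightarrow> nat" where
  "pair_count K i n = (\<Sum>E\<in>inc_trees {..<n}. count_vertices K i {..<n} E)"

section \<open>Invariance of ranks, sizes and counts under order-preserving relabelling\<close>

context
  fixes f :: "nat \<Rightarrow> nat"
  assumes f: "strict_mono f"
begin

private lemma f_inj: "inj f"
  using f by (rule strict_mono_imp_inj_on)

private lemma f_eq_iff: "f a = f b \<longleftrightarrow> a = b"
  using f_inj by (simp add: inj_eq)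

text \<open>Leaves, ranks and subtrees are all determined by powers of \<open>E\<close>, so this one
  equivalence carries them over. It also says that an image vertex has only image vertices below it,
  whatever lies outside the range of \<open>f\<close>.\<close>

lemma relpow_relabel:
  "(x, f v) \<in> (map_prod f f ` E) ^^ d \<longleftrightarrow> (\<exists>u. x = f u \<and> (u, v) \<in> E ^^ d)"
proof (induction d arbitrary: v)
  case 0
  show ?case by (auto simp: f_eq_iff)
next
  case (Suc d)
  have step: "(y, f v) \<in> map_prod f f ` E \<longleftrightarrow> (\<exists>w. y = f w \<and> (w, v) \<in> E)" for y
    by (force simp: image_iff f_eq_iff)
  have "(x, f v) \<in> (map_prod f f ` E) ^^ Suc d \<longleftrightarrow>
      (\<exists>w. (x, f w) \<in> (map_prod f f ` E) ^^ d \<and> (w, v) \<in> E)"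
    by (simp only: relpow.simps relcomp_unfold mem_Collect_eq prod.case step) blast
  also have "\<dots> \<longleftrightarrow> (\<exists>u. x = f u \<and> (\<exists>w. (u, w) \<in> E ^^ d \<and> (w, v) \<in> E))"
    unfolding Suc.IH by blast
  also have "\<dots> \<longleftrightarrow> (\<exists>u. x = f u \<and> (u, v) \<in> E ^^ Suc d)"
    by (simp only: relpow.simps relcomp_unfold mem_Collect_eq prod.case)
  finally show ?case .
qed

lemma children_relabel: "children (map_prod f f ` E) (f v) = f ` children E v"
  using relpow_relabel[of _ v 1 E] by (auto simp: children_def)

lemma is_leaf_relabel: "is_leaf (map_prod f f ` E) (f v) \<longleftrightarrow> is_leaf E v"
  by (simp add: is_leaf_def children_relabel)

lemma vertex_rank_relabel: "vertex_rank (map_prod f f ` E) (f v) = vertex_rank E v"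
proof -
  have "(\<exists>l. is_leaf (map_prod f f ` E) l \<and> (l, f v) \<in> (map_prod f f ` E) ^^ d) \<longleftrightarrow>
        (\<exists>l. is_leaf E l \<and> (l, v) \<in> E ^^ d)" for d
    using is_leaf_relabel by (auto simp: relpow_relabel)
  then show ?thesis by (simp add: vertex_rank_def)
qed

lemma card_subtree_relabel:
  "card (subtree_vertices (map_prod f f ` E) (f v)) = card (subtree_vertices E v)"
proof -
  have "subtree_vertices (map_prod f f ` E) (f v) = f ` subtree_vertices E v"
    by (auto simp: subtree_vertices_def rtrancl_is_UN_relpow relpow_relabel)
  then show ?thesis by (simp add: card_image inj_on_subset[OF f_inj])
qed

lemma Max_relabel: "finite V \<Longrightarrow> V \<noteq> {} \<Longrightarrow> Max (f ` V) = f (Max V)"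
  using mono_Max_commute[of f V] strict_mono_mono[OF f] by simp

lemma relabel_in_inc_trees_iff:
  assumes "finite V" "E \<subseteq> V \<times> V"
  shows "map_prod f f ` E \<in> inc_trees (f ` V) \<longleftrightarrow> E \<in> inc_trees V"
proof (cases "V = {}")
  case False
  note [simp] = f_eq_iff
  have mem: "(f a, f b) \<in> map_prod f f ` E \<longleftrightarrow> (a, b) \<in> E" for a b
    using relpow_relabel[of "f a" b 1 E] by auto
  have ex: "(\<exists>!p. (f v, p) \<in> map_prod f f ` E) \<longleftrightarrow> (\<exists>!p. (v, p) \<in> E)" for v
  proof -
    have "(f v, p) \<in> map_prod f f ` E \<longleftrightarrow> (\<exists>q. p = f q \<and> (v, q) \<in> E)" for p
      by (force simp: image_iff)
    moreover have "(\<exists>!p. \<exists>q. p = f q \<and> Q q) \<longleftrightarrow> (\<exists>!q. Q q)" for Q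
    proof
      assume "\<exists>!p. \<exists>q. p = f q \<and> Q q"
      then obtain q where q: "Q q" and u: "\<And>p. \<exists>q'. p = f q' \<and> Q q' \<Longrightarrow> p = f q" by auto
      show "\<exists>!q. Q q"
      proof (rule ex1I[of _ q])
        fix q' assume "Q q'"
        then have "f q' = f q" by (intro u) blast
        then show "q' = q" by simp
      qed (rule q)
    qed auto
    ultimately show ?thesis by simp
  qed
  have "card (children (map_prod f f ` E) (f v)) = card (children E v)" for v
    by (simp add: children_relabel card_image inj_on_subset[OF f_inj])
  moreover have "map_prod f f ` E \<subseteq> f ` V \<times> f ` V" using assms by auto
  moreover have "(\<forall>(c, p)\<in>map_prod f f ` E. c < p) \<longleftrightarrow> (\<forall>(c, p)\<in>E. c < p)"
    by (simp add: strict_mono_less[OF f] split_beta)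
  moreover have "f ` V - {Max (f ` V)} = f ` (V - {Max V})"
    using Max_relabel[OF assms(1) False] by auto
  ultimately show ?thesis
    using assms(2) by (simp add: inc_trees_def ex)
qed (use assms in \<open>auto simp: inc_trees_empty\<close>)

lemma bij_betw_relabel:
  assumes "finite V"
  shows "bij_betw (image (map_prod f f)) (inc_trees V) (inc_trees (f ` V))"
proof (rule bij_betw_imageI)
  have "inj (map_prod f f)" using f_inj by (simp add: prod.inj_map)
  then show "inj_on (image (map_prod f f)) (inc_trees V)"
    by (intro inj_onI) (simp only: inj_image_eq_iff)
  show "image (map_prod f f) ` inc_trees V = inc_trees (f ` V)"
  proof (intro equalityI subsetI)
    fix E' assume E': "E' \<in> inc_trees (f ` V)"
    define E where "E = {(a, b). a \<in> V \<and> b \<in> V \<and> (f a, f b) \<in> E'}"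
    have "E' = map_prod f f ` E"
      using inc_treesD(1)[OF E'] unfolding E_def by (auto simp: image_iff)
    moreover have "E \<subseteq> V \<times> V" by (auto simp: E_def)
    ultimately show "E' \<in> image (map_prod f f) ` inc_trees V"
      using relabel_in_inc_trees_iff[OF assms] E' by blast
  next
    fix E' assume "E' \<in> image (map_prod f f) ` inc_trees V"
    then show "E' \<in> inc_trees (f ` V)"
      using relabel_in_inc_trees_iff[OF assms] inc_treesD(1) by blast
  qed
qed

lemma count_vertices_relabel:
  "count_vertices K i (f ` V) (map_prod f f ` E) = count_vertices K i V E"
proof -
  have "{v \<in> f ` V. vertex_rank (map_prod f f ` E) v \<in> K \<and>
          card (subtree_vertices (map_prod f f ` E) v) = i}
      = f ` {v \<in> V. vertex_rank E v \<in> K \<and> card (subtree_vertices E v) = i}"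
    by (auto simp: vertex_rank_relabel card_subtree_relabel)
  then show ?thesis
    unfolding count_vertices_def by (simp add: card_image inj_on_subset[OF f_inj])
qed

lemma card_inc_trees_relabel: "finite V \<Longrightarrow> card (inc_trees (f ` V)) = card (inc_trees V)"
  by (rule bij_betw_same_card[OF bij_betw_relabel, symmetric])

lemma sum_count_vertices_relabel:
  "finite V \<Longrightarrow> (\<Sum>E\<in>inc_trees (f ` V). count_vertices K i (f ` V) E)
     = (\<Sum>E\<in>inc_trees V. count_vertices K i V E)"
  unfolding sum.reindex_bij_betw[OF bij_betw_relabel, symmetric] count_vertices_relabel ..

end

text \<open>\<open>f\<close> must be strictly increasing on all of \<open>nat\<close>, so
  \<open>V\<close> is prolonged by every number above its maximum and the infinite union is
  enumerated in order; \<open>V\<close> is an initial segment of it.\<close>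

lemma obtain_strict_mono_onto:
  fixes V :: "nat set"
  assumes "finite V"
  obtains f :: "nat \<Rightarrow> nat" where "strict_mono f" "f ` {..<card V} = V"
proof -
  define S where "S = V \<union> {Max V<..}"
  have inf: "infinite S" unfolding S_def using infinite_Ioi[of "Max V"] by simp
  have sm: "strict_mono (enumerate S)" using inf by (simp add: strict_mono_def)
  have lt: "w < y" if "w \<in> V" "y \<in> S" "y \<notin> V" for w y
    using that Max_ge[OF assms, of w] by (auto simp: S_def)
  have "V = enumerate S ` {..<card V}"
  proof (rule card_seteq)
    show "finite (enumerate S ` {..<card V})" by simp
    show "card (enumerate S ` {..<card V}) \<le> card V"
      using card_image_le[of "{..<card V}" "enumerate S"] by simp
    show "V \<subseteq> enumerate S ` {..<card V}"
    proof
      fix w assume w: "w \<in> V"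
      then have "w \<in> S" by (simp add: S_def)
      then obtain j where j: "enumerate S j = w" using enumerate_Ex[OF inf] by blast
      \<comment> \<open>Everything in \<open>S\<close> up to \<open>w\<close> lies in
        \<open>V\<close>, so \<open>j + 1\<close> distinct values fit into \<open>V\<close>, which
        forces \<open>j < card V\<close>.\<close>
      have "enumerate S ` {..j} \<subseteq> V"
      proof
        fix y assume "y \<in> enumerate S ` {..j}"
        then obtain l where "l \<le> j" "y = enumerate S l" by blast
        then have "y \<le> w" using j strict_mono_less_eq[OF sm, of l j] by simp
        moreover have "y \<in> S" using \<open>y = enumerate S l\<close> enumerate_in_set[OF inf] by simp
        ultimately show "y \<in> V" using lt[OF w, of y] by (cases "y \<in> V") auto
      qed
      then have "card (enumerate S ` {..j}) \<le> card V" by (rule card_mono[OF assms])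
      then have "j < card V"
        using card_image[OF inj_on_subset[OF strict_mono_imp_inj_on[OF sm] subset_UNIV, of "{..j}"]]
        by simp
      then show "w \<in> enumerate S ` {..<card V}" using j by auto
    qed
  qed
  then show ?thesis using that[OF sm] by simp
qed

lemma card_inc_trees:
  assumes "finite V"
  shows "card (inc_trees V) = tree_count (card V)"
proof -
  obtain f :: "nat \<Rightarrow> nat" where "strict_mono f" "f ` {..<card V} = V"
    using obtain_strict_mono_onto[OF assms] .
  then show ?thesis
    using card_inc_trees_relabel[of f "{..<card V}"] by (simp add: tree_count_def)
qed

lemma sum_count_vertices:
  assumes "finite V"
  shows "(\<Sum>E\<in>inc_trees V. count_vertices K i V E) = pair_count K i (card V)"
proof -
  obtain f :: "nat \<Rightarrow> nat" where "strict_mono f" "f ` {..<card V} = V"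
    using obtain_strict_mono_onto[OF assms] .
  then show ?thesis
    using sum_count_vertices_relabel[of f "{..<card V}"] by (simp add: pair_count_def)
qed

subsection \<open>Decomposition at the root\<close>

text \<open>\<open>A\<close> is closed under passing to children: every edge of \<open>E\<close>
  into \<open>A\<close> is an edge of \<open>E'\<close> and hence starts in \<open>A\<close>. Paths
  that end in \<open>A\<close> therefore lie entirely in it, and whatever is defined from
  descendants can be computed in \<open>E'\<close> alone.\<close>

lemma relpow_downset:
  assumes "E' \<subseteq> A \<times> A" and "\<And>c p. p \<in> A \<Longrightarrow> (c, p) \<in> E \<longleftrightarrow> (c, p) \<in> E'" and "v \<in> A"
  shows "(l, v) \<in> E ^^ d \<longleftrightarrow> (l, v) \<in> E' ^^ d" and "(l, v) \<in> E ^^ d \<Longrightarrow> l \<in> A"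
proof -
  have "((l, v) \<in> E ^^ d \<longleftrightarrow> (l, v) \<in> E' ^^ d) \<and> ((l, v) \<in> E ^^ d \<longrightarrow> l \<in> A)"
    using assms(3)
  proof (induction d arbitrary: v)
    case (Suc d)
    have step: "(w, v) \<in> E \<longleftrightarrow> (w, v) \<in> E' \<and> w \<in> A" for w
      using assms(1,2) Suc.prems by blast
    have E': "(w, v) \<in> E' \<longleftrightarrow> (w, v) \<in> E' \<and> w \<in> A" for w
      using assms(1) by blast
    have "(l, v) \<in> E ^^ Suc d \<longleftrightarrow> (\<exists>w. (l, w) \<in> E ^^ d \<and> (w, v) \<in> E' \<and> w \<in> A)"
      by (simp only: relpow.simps relcomp_unfold mem_Collect_eq prod.case step)
    also have "\<dots> \<longleftrightarrow> (\<exists>w. (l, w) \<in> E' ^^ d \<and> (w, v) \<in> E' \<and> w \<in> A)"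
      using Suc.IH by blast
    also have "\<dots> \<longleftrightarrow> (l, v) \<in> E' ^^ Suc d"
      by (simp only: relpow.simps relcomp_unfold mem_Collect_eq prod.case E'[symmetric])
    finally have eq: "(l, v) \<in> E ^^ Suc d \<longleftrightarrow> (l, v) \<in> E' ^^ Suc d" .
    moreover have "l \<in> A" if "(l, v) \<in> E ^^ Suc d"
    proof -
      from that obtain w where "(l, w) \<in> E ^^ d" "(w, v) \<in> E" by auto
      then show ?thesis using step Suc.IH by blast
    qed
    ultimately show ?case by blast
  qed simp
  then show "(l, v) \<in> E ^^ d \<longleftrightarrow> (l, v) \<in> E' ^^ d" "(l, v) \<in> E ^^ d \<Longrightarrow> l \<in> A"
    by auto
qed

lemma subtree_vertices_downset:
  assumes "E' \<subseteq> A \<times> A" and "\<And>c p. p \<in> A \<Longrightarrow> (c, p) \<in> E \<longleftrightarrow> (c, p) \<in> E'" and "v \<in> A"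
  shows "subtree_vertices E v = subtree_vertices E' v"
  using relpow_downset(1)[OF assms] by (simp add: subtree_vertices_def rtrancl_is_UN_relpow)

lemma vertex_rank_downset:
  assumes "E' \<subseteq> A \<times> A" and "\<And>c p. p \<in> A \<Longrightarrow> (c, p) \<in> E \<longleftrightarrow> (c, p) \<in> E'" and "v \<in> A"
  shows "vertex_rank E v = vertex_rank E' v"
proof -
  have leaf: "is_leaf E l \<longleftrightarrow> is_leaf E' l" if "l \<in> A" for l
    using assms(2)[OF that] by (simp add: is_leaf_def children_def)
  have "(is_leaf E l \<and> (l, v) \<in> E ^^ d) \<longleftrightarrow> (is_leaf E' l \<and> (l, v) \<in> E' ^^ d)" for l d
    using relpow_downset[OF assms] leaf by blast
  then show ?thesis by (simp add: vertex_rank_def)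
qed

lemma count_vertices_downset:
  assumes "E' \<subseteq> A \<times> A" and "\<And>c p. p \<in> A \<Longrightarrow> (c, p) \<in> E \<longleftrightarrow> (c, p) \<in> E'"
  shows "count_vertices K i A E = count_vertices K i A E'"
proof -
  have "{v \<in> A. vertex_rank E v \<in> K \<and> card (subtree_vertices E v) = i}
      = {v \<in> A. vertex_rank E' v \<in> K \<and> card (subtree_vertices E' v) = i}"
    using subtree_vertices_downset[OF assms] vertex_rank_downset[OF assms] by auto
  then show ?thesis by (simp add: count_vertices_def)
qed

lemma subtree_vertices_Max:
  assumes "finite V" "V \<noteq> {}" "E \<in> inc_trees V"
  shows "subtree_vertices E (Max V) = V"
proof -
  have "Max V \<in> V" using assms(1,2) by simp
  moreover have "u \<in> V" if "(u, Max V) \<in> E\<^sup>*" for u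
    using that \<open>Max V \<in> V\<close> inc_treesD(1)[OF assms(3)] by (induction rule: converse_rtrancl_induct) auto
  ultimately show ?thesis
    using inc_trees_reach_Max[OF assms(1,3)] by (auto simp: subtree_vertices_def)
qed

text \<open>\<open>Max A\<close> and \<open>Max B\<close> are the roots of the two branches. An
  empty \<open>B\<close> contributes no edge and leaves \<open>m\<close> with a single
  child.\<close>

definition graft :: "nat \<Rightarrow> nat set \<Rightarrow> nat set \<Rightarrow> (nat \<times> nat) set \<Rightarrow> (nat \<times> nat) set \<Rightarrow> (nat \<times> nat) set"
  where "graft m A B E1 E2 = E1 \<union> E2 \<union> {(Max A, m)} \<union> (if B = {} then {} else {(Max B, m)})"

context
  fixes m :: nat and U :: "nat set"
  assumes finU: "finite U" and neU: "U \<noteq> {}" and less_m: "\<And>u. u \<in> U \<Longrightarrow> u < m"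
begin

lemma Max_insert_root: "Max (insert m U) = m"
  using finU less_m by (intro Max_eqI) (auto intro: less_imp_le)

context
  fixes A E1 E2
  assumes A: "A \<subseteq> U" "Max U \<in> A" and E1: "E1 \<in> inc_trees A" and E2: "E2 \<in> inc_trees (U - A)"
begin

private lemma fin: "finite A" "finite (U - A)"
  using A finU by (auto intro: finite_subset)

private lemma Max_A: "Max A = Max U"
  using A finU fin by (intro Max_eqI) (auto intro: Max_ge)

private lemma m_notin: "m \<notin> U"
  using less_m by blast

private lemma Max_B: "U - A \<noteq> {} \<Longrightarrow> Max (U - A) \<in> U - A"
  using fin(2) Max_in by blast

lemma graft_parent_left:
  assumes "v \<in> A"
  shows "(v, p) \<in> graft m A (U - A) E1 E2 \<longleftrightarrow> (v, p) \<in> E1 \<or> (v = Max A \<and> p = m)"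
proof -
  have "(v, p) \<notin> E2" using inc_treesD(1)[OF E2] assms by blast
  moreover have "U - A \<noteq> {} \<Longrightarrow> v \<noteq> Max (U - A)" using Max_B assms by blast
  ultimately show ?thesis by (auto simp: graft_def)
qed

lemma graft_parent_right:
  assumes "v \<in> U - A"
  shows "(v, p) \<in> graft m A (U - A) E1 E2 \<longleftrightarrow> (v, p) \<in> E2 \<or> (v = Max (U - A) \<and> p = m)"
proof -
  have "(v, p) \<notin> E1" using inc_treesD(1)[OF E1] assms by blast
  moreover have "v \<noteq> Max A" using Max_A A assms by auto
  moreover have "U - A \<noteq> {}" using assms by blast
  ultimately show ?thesis by (auto simp: graft_def)
qed

lemma graft_child_left:
  assumes "p \<in> A"
  shows "(c, p) \<in> graft m A (U - A) E1 E2 \<longleftrightarrow> (c, p) \<in> E1"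
  using assms inc_treesD(1)[OF E2] m_notin A(1) by (auto simp: graft_def)

lemma graft_child_right:
  assumes "p \<in> U - A"
  shows "(c, p) \<in> graft m A (U - A) E1 E2 \<longleftrightarrow> (c, p) \<in> E2"
  using assms inc_treesD(1)[OF E1] m_notin by (auto simp: graft_def)

text \<open>One statement for both branches: non-roots keep their parent, and the branch root,
  parentless so far, receives \<open>m\<close> alone.\<close>

lemma unique_parent_or_root:
  assumes "finite W" "F \<in> inc_trees W" "v \<in> W" "W \<subseteq> U"
  shows "\<exists>!p. (v, p) \<in> F \<or> (v = Max W \<and> p = m)"
proof (cases "v = Max W")
  case True
  then show ?thesis using inc_trees_Max_no_parent[OF assms(1,2)] by auto
next
  case False
  then show ?thesis using inc_treesD(3)[OF assms(2,3) False] by auto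
qed

lemma graft_in_inc_trees: "graft m A (U - A) E1 E2 \<in> inc_trees (insert m U)"
proof (rule inc_treesI)
  let ?G = "graft m A (U - A) E1 E2"
  have aU: "Max A \<in> U" using Max_A A by auto
  show "?G \<subseteq> insert m U \<times> insert m U"
    using inc_treesD(1)[OF E1] inc_treesD(1)[OF E2] A aU Max_B by (auto simp: graft_def split: if_splits)
  show "c < p" if "(c, p) \<in> ?G" for c p
    using that inc_treesD(2)[OF E1] inc_treesD(2)[OF E2] less_m aU Max_B
    by (auto simp: graft_def split: if_splits)
  show "\<exists>!p. (v, p) \<in> ?G" if "v \<in> insert m U" "v \<noteq> Max (insert m U)" for v
  proof -
    have "v \<in> U" using that Max_insert_root by auto
    show ?thesis
    proof (cases "v \<in> A")
      case True
      show ?thesis unfolding graft_parent_left[OF True]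
        by (rule unique_parent_or_root[OF fin(1) E1 True A(1)])
    next
      case False
      then have v: "v \<in> U - A" using \<open>v \<in> U\<close> by blast
      show ?thesis unfolding graft_parent_right[OF v]
        by (rule unique_parent_or_root[OF fin(2) E2 v]) blast
    qed
  qed
  show "card (children ?G v) \<le> 2" if "v \<in> insert m U" for v
  proof -
    consider "v = m" | "v \<in> A" | "v \<in> U - A" using \<open>v \<in> insert m U\<close> by blast
    then show ?thesis
    proof cases
      case 1
      \<comment> \<open>For \<open>U - A = {}\<close> the term \<open>Max (U - A)\<close> is an
        unspecified number; this does no harm to an upper bound on the children.\<close>
      have "children ?G v \<subseteq> {Max A, Max (U - A)}"
        using 1 m_notin inc_treesD(1)[OF E1] inc_treesD(1)[OF E2] A(1)
        by (auto simp: children_def graft_def split: if_splits)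
      then have "card (children ?G v) \<le> card {Max A, Max (U - A)}" by (intro card_mono) auto
      also have "\<dots> \<le> 2" by (simp add: card_insert_if)
      finally show ?thesis .
    next
      case 2
      then have "children ?G v = children E1 v" by (simp add: children_def graft_child_left)
      then show ?thesis using inc_treesD(4)[OF E1 2] by simp
    next
      case 3
      then have "children ?G v = children E2 v" by (simp add: children_def graft_child_right)
      then show ?thesis using inc_treesD(4)[OF E2 3] by simp
    qed
  qed
qed

text \<open>\<open>A\<close> is recovered from the grafted tree as the subtree of the second largest
  label; together with \<open>graft_restrict\<close> this makes grafting injective.\<close>

lemma subtree_graft: "subtree_vertices (graft m A (U - A) E1 E2) (Max U) = A"
proof -
  have "A \<noteq> {}" using A(2) by blast
  then show ?thesis
    using subtree_vertices_downset[OF inc_treesD(1)[OF E1] graft_child_left A(2)]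
      subtree_vertices_Max[OF fin(1) _ E1] by (simp add: Max_A)
qed

lemma graft_restrict:
  "graft m A (U - A) E1 E2 \<inter> A \<times> A = E1"
  "graft m A (U - A) E1 E2 \<inter> (U - A) \<times> (U - A) = E2"
proof -
  show "graft m A (U - A) E1 E2 \<inter> A \<times> A = E1"
  proof (intro equalityI subrelI)
    fix c p assume "(c, p) \<in> graft m A (U - A) E1 E2 \<inter> A \<times> A"
    then show "(c, p) \<in> E1" using graft_child_left by blast
  next
    fix c p assume cp: "(c, p) \<in> E1"
    then have "c \<in> A" "p \<in> A" using inc_treesD(1)[OF E1] by auto
    then show "(c, p) \<in> graft m A (U - A) E1 E2 \<inter> A \<times> A" using cp graft_child_left by simp
  qed
  show "graft m A (U - A) E1 E2 \<inter> (U - A) \<times> (U - A) = E2"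
  proof (intro equalityI subrelI)
    fix c p assume "(c, p) \<in> graft m A (U - A) E1 E2 \<inter> (U - A) \<times> (U - A)"
    then show "(c, p) \<in> E2" using graft_child_right by blast
  next
    fix c p assume cp: "(c, p) \<in> E2"
    then have "c \<in> U - A" "p \<in> U - A" using inc_treesD(1)[OF E2] by auto
    then show "(c, p) \<in> graft m A (U - A) E1 E2 \<inter> (U - A) \<times> (U - A)"
      using cp graft_child_right by simp
  qed
qed

text \<open>Rank and subtree size of a vertex depend only on what lies below it, so vertices other
  than the root are counted within their branch; the subtree of the root is everything.\<close>

lemma count_vertices_graft:
  "count_vertices K i (insert m U) (graft m A (U - A) E1 E2) =
     (if vertex_rank (graft m A (U - A) E1 E2) m \<in> K \<and> card (insert m U) = i then 1 else 0)
     + count_vertices K i A E1 + count_vertices K i (U - A) E2"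
proof -
  let ?G = "graft m A (U - A) E1 E2"
  let ?P = "\<lambda>v. vertex_rank ?G v \<in> K \<and> card (subtree_vertices ?G v) = i"
  have "subtree_vertices ?G m = insert m U"
    using subtree_vertices_Max[OF _ _ graft_in_inc_trees] finU Max_insert_root by simp
  then have root: "card {v \<in> {m}. ?P v} =
      (if vertex_rank ?G m \<in> K \<and> card (insert m U) = i then 1 else 0)"
    by (auto simp: Collect_conv_if)
  have split: "{v \<in> insert m U. ?P v} = {v \<in> {m}. ?P v} \<union> {v \<in> A. ?P v} \<union> {v \<in> U - A. ?P v}"
    using A(1) by blast
  have "card {v \<in> insert m U. ?P v}
      = card {v \<in> {m}. ?P v} + card {v \<in> A. ?P v} + card {v \<in> U - A. ?P v}"
    unfolding split using fin m_notin A(1)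
    by (subst card_Un_disjoint; (subst card_Un_disjoint)?) auto
  also have "card {v \<in> A. ?P v} = count_vertices K i A E1"
    using count_vertices_downset[OF inc_treesD(1)[OF E1] graft_child_left]
    by (simp add: count_vertices_def)
  also have "card {v \<in> U - A. ?P v} = count_vertices K i (U - A) E2"
    using count_vertices_downset[OF inc_treesD(1)[OF E2] graft_child_right]
    by (simp add: count_vertices_def)
  finally show ?thesis unfolding root by (simp add: count_vertices_def)
qed

end

text \<open>The children of \<open>m\<close> are unordered, but the branch containing the second
  largest label \<open>Max U\<close> can always be named first. \<open>Max U\<close> is a child of
  \<open>m\<close>, as only \<open>m\<close> exceeds it; the rest, if any, is a single branch with
  root \<open>Max (U - A)\<close>, because \<open>m\<close> has at most two children.\<close>

lemma inc_tree_eq_graft: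
  assumes E: "E \<in> inc_trees (insert m U)"
  defines "A \<equiv> subtree_vertices E (Max U)"
  shows "A \<subseteq> U" "Max U \<in> A" "E \<inter> A \<times> A \<in> inc_trees A"
    "E \<inter> (U - A) \<times> (U - A) \<in> inc_trees (U - A)"
    "E = graft m A (U - A) (E \<inter> A \<times> A) (E \<inter> (U - A) \<times> (U - A))"
proof -
  let ?V = "insert m U" and ?a = "Max U" and ?B = "U - A"
  have finV: "finite ?V" using finU by simp
  have mU: "m \<notin> U" using less_m by blast
  have aU: "?a \<in> U" using finU neU by simp
  have a_ge: "u \<le> ?a" if "u \<in> U" for u using that finU by simp
  have par: "p \<in> ?V" "c \<in> U" "c < p" if "(c, p) \<in> E" for c p
    using that inc_treesD(1,2)[OF E] inc_trees_Max_no_parent[OF finV E, of p] Max_insert_root by auto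
  have uniq: "p = q" if "(v, p) \<in> E" "(v, q) \<in> E" for v p q
    using inc_trees_parent_unique[OF finV E that] .
  have ex: "\<exists>p. (v, p) \<in> E" if "v \<in> U" for v
    using inc_treesD(3)[OF E, of v] that mU Max_insert_root by auto
  show aA: "?a \<in> A" by (simp add: A_def subtree_vertices_def)
  show AU: "A \<subseteq> U"
  proof
    fix u assume "u \<in> A"
    then have "(u, ?a) \<in> E\<^sup>*" by (simp add: A_def subtree_vertices_def)
    then show "u \<in> U" using aU par(2) by (induction rule: converse_rtrancl_induct) auto
  qed
  have A_closed: "c \<in> A" if "(c, p) \<in> E" "p \<in> A" for c p
    using that by (auto simp: A_def subtree_vertices_def intro: converse_rtrancl_into_rtrancl)
  have A_up: "p \<in> A" if "(c, p) \<in> E" "c \<in> A" "c \<noteq> ?a" for c p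
  proof -
    have "(c, ?a) \<in> E\<^sup>*" using that(2) by (simp add: A_def subtree_vertices_def)
    with \<open>c \<noteq> ?a\<close> obtain q where "(c, q) \<in> E" "(q, ?a) \<in> E\<^sup>*"
      by (auto elim: converse_rtranclE)
    then show ?thesis using uniq[OF that(1)] by (auto simp: A_def subtree_vertices_def)
  qed
  have finA: "finite A" and finB: "finite ?B" using AU finU by (auto intro: finite_subset)
  have MaxA: "Max A = ?a" using aA AU a_ge finA by (intro Max_eqI) auto
  have am: "(?a, m) \<in> E"
  proof -
    obtain p where p: "(?a, p) \<in> E" using ex aU by blast
    then have "p = m" using par[OF p] a_ge[of p] by auto
    then show ?thesis using p by simp
  qed
  have B_up: "p \<in> ?B \<or> p = m" if "(c, p) \<in> E" "c \<in> ?B" for c p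
    using that par(1)[OF that(1)] A_closed by blast
  \<comment> \<open>The parent of \<open>Max ?B\<close> is larger, so outside \<open>?B\<close>; nor
    is it in \<open>A\<close>, which contains all children of its members.\<close>
  have bm: "(Max ?B, m) \<in> E" if "?B \<noteq> {}"
  proof -
    have b: "Max ?B \<in> ?B" using finB that by (rule Max_in)
    then obtain p where p: "(Max ?B, p) \<in> E" using ex by blast
    have "p \<notin> ?B" using par(3)[OF p] Max_ge[OF finB, of p] by auto
    then have "p = m" using B_up[OF p b] by blast
    then show ?thesis using p by simp
  qed
  \<comment> \<open>A further child \<open>c\<close> of \<open>m\<close> would lie in
    \<open>?B\<close> and be the third one besides \<open>?a\<close> and
    \<open>Max ?B\<close>.\<close>
  have root_children: "c = ?a \<or> c = Max ?B" if c: "(c, m) \<in> E" for c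
  proof (rule ccontr)
    assume neq: "\<not> (c = ?a \<or> c = Max ?B)"
    then have "c \<notin> A" using A_up[OF c] AU mU by blast
    then have cB: "c \<in> ?B" using par(2)[OF c] by blast
    then have "{c, ?a, Max ?B} \<subseteq> children E m" using c am bm by (auto simp: children_def)
    moreover have "finite (children E m)"
      using children_finite[OF inc_treesD(1)[OF E] finV] .
    ultimately have "card {c, ?a, Max ?B} \<le> 2"
      using inc_treesD(4)[OF E, of m] card_mono[of "children E m" "{c, ?a, Max ?B}"] by simp
    moreover have "Max ?B \<in> ?B" using cB by (intro Max_in[OF finB]) blast
    then have "?a \<noteq> Max ?B" using aA by auto
    ultimately show False using neq by simp
  qed
  show E1: "E \<inter> A \<times> A \<in> inc_trees A"
  proof (rule inc_treesI)
    show "\<exists>!p. (v, p) \<in> E \<inter> A \<times> A" if "v \<in> A" "v \<noteq> Max A" for v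
    proof -
      obtain p where p: "(v, p) \<in> E" using ex \<open>v \<in> A\<close> AU by blast
      then have "(v, p) \<in> E \<inter> A \<times> A" using A_up that MaxA by auto
      then show ?thesis using uniq by blast
    qed
    show "card (children (E \<inter> A \<times> A) v) \<le> 2" if "v \<in> A" for v
    proof -
      have "card (children (E \<inter> A \<times> A) v) \<le> card (children E v)"
        by (intro card_mono children_finite[OF inc_treesD(1)[OF E] finV]) (auto simp: children_def)
      then show ?thesis using inc_treesD(4)[OF E, of v] that AU by auto
    qed
  qed (use par in auto)
  show E2: "E \<inter> ?B \<times> ?B \<in> inc_trees ?B"
  proof (rule inc_treesI)
    show "\<exists>!p. (v, p) \<in> E \<inter> ?B \<times> ?B" if "v \<in> ?B" "v \<noteq> Max ?B" for v
    proof -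
      obtain p where p: "(v, p) \<in> E" using ex \<open>v \<in> ?B\<close> by blast
      have "p \<noteq> m" using root_children[of v] p that aA by blast
      then have "(v, p) \<in> E \<inter> ?B \<times> ?B" using B_up[OF p \<open>v \<in> ?B\<close>] p that by blast
      then show ?thesis using uniq by blast
    qed
    show "card (children (E \<inter> ?B \<times> ?B) v) \<le> 2" if "v \<in> ?B" for v
    proof -
      have "card (children (E \<inter> ?B \<times> ?B) v) \<le> card (children E v)"
        by (intro card_mono children_finite[OF inc_treesD(1)[OF E] finV]) (auto simp: children_def)
      then show ?thesis using inc_treesD(4)[OF E, of v] that by auto
    qed
  qed (use par in auto)
  show "E = graft m A ?B (E \<inter> A \<times> A) (E \<inter> ?B \<times> ?B)"
  proof (intro equalityI subsetI)
    fix e assume "e \<in> E"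
    then obtain c p where e: "e = (c, p)" "(c, p) \<in> E" by (cases e) auto
    consider "c = ?a" | "c \<in> A" "c \<noteq> ?a" | "c \<in> ?B" using par(2)[OF e(2)] by blast
    then show "e \<in> graft m A ?B (E \<inter> A \<times> A) (E \<inter> ?B \<times> ?B)"
    proof cases
      case 1
      then have "p = m" using uniq[of ?a p m] am e by simp
      then show ?thesis using 1 e MaxA by (simp add: graft_def)
    next
      case 2
      then show ?thesis using A_up[OF e(2)] e by (simp add: graft_def)
    next
      case 3
      then have neB: "?B \<noteq> {}" by blast
      from B_up[OF e(2) 3] show ?thesis
      proof
        assume "p \<in> ?B"
        then show ?thesis using e 3 by (simp add: graft_def)
      next
        assume pm: "p = m"
        then have "c = Max ?B" using root_children[of c] e 3 aA by blast
        then show ?thesis using pm e neB by (simp add: graft_def)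
      qed
    qed
  next
    fix e assume "e \<in> graft m A ?B (E \<inter> A \<times> A) (E \<inter> ?B \<times> ?B)"
    then show "e \<in> E" using am bm MaxA by (auto simp: graft_def split: if_splits)
  qed
qed

lemma bij_betw_graft:
  "bij_betw (\<lambda>(A, E1, E2). graft m A (U - A) E1 E2)
     (SIGMA A:{A. A \<subseteq> U \<and> Max U \<in> A}. inc_trees A \<times> inc_trees (U - A)) (inc_trees (insert m U))"
proof (rule bij_betw_byWitness[where f' = "\<lambda>E. let A = subtree_vertices E (Max U) in
    (A, E \<inter> A \<times> A, E \<inter> (U - A) \<times> (U - A))"])
  show "\<forall>x\<in>SIGMA A:{A. A \<subseteq> U \<and> Max U \<in> A}. inc_trees A \<times> inc_trees (U - A).
      (let A = subtree_vertices (case x of (A, E1, E2) \<Rightarrow> graft m A (U - A) E1 E2) (Max U)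
       in (A, (case x of (A, E1, E2) \<Rightarrow> graft m A (U - A) E1 E2) \<inter> A \<times> A,
          (case x of (A, E1, E2) \<Rightarrow> graft m A (U - A) E1 E2) \<inter> (U - A) \<times> (U - A))) = x"
    by (auto simp: subtree_graft graft_restrict)
  show "\<forall>E\<in>inc_trees (insert m U). (case let A = subtree_vertices E (Max U) in
      (A, E \<inter> A \<times> A, E \<inter> (U - A) \<times> (U - A)) of (A, E1, E2) \<Rightarrow> graft m A (U - A) E1 E2) = E"
    unfolding Let_def prod.case using inc_tree_eq_graft(5) by simp
  show "(\<lambda>(A, E1, E2). graft m A (U - A) E1 E2) `
      (SIGMA A:{A. A \<subseteq> U \<and> Max U \<in> A}. inc_trees A \<times> inc_trees (U - A)) \<subseteq> inc_trees (insert m U)"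
    using graft_in_inc_trees by auto
  show "(\<lambda>E. let A = subtree_vertices E (Max U) in (A, E \<inter> A \<times> A, E \<inter> (U - A) \<times> (U - A))) `
      inc_trees (insert m U) \<subseteq>
      (SIGMA A:{A. A \<subseteq> U \<and> Max U \<in> A}. inc_trees A \<times> inc_trees (U - A))"
    using inc_tree_eq_graft(1-4) by (auto simp: Let_def)
qed

text \<open>Stated for arbitrary \<open>g\<close>: the constant 1 counts trees, and a vertex count
  gives the recurrence for pairs. Read from right to left it also reassembles the terms that belong
  to the root.\<close>

lemma sum_inc_trees_graft:
  fixes g :: "(nat \<times> nat) set \<Rightarrow> nat"
  shows "(\<Sum>E\<in>inc_trees (insert m U). g E) = (\<Sum>A | A \<subseteq> U \<and> Max U \<in> A.
    \<Sum>E1\<in>inc_trees A. \<Sum>E2\<in>inc_trees (U - A). g (graft m A (U - A) E1 E2))"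
proof -
  have fin: "finite {A. A \<subseteq> U \<and> Max U \<in> A}"
    by (rule finite_subset[of _ "Pow U"]) (use finU in auto)
  have finA: "finite (inc_trees A \<times> inc_trees (U - A))" if "A \<subseteq> U" for A
    using that finU by (intro finite_cartesian_product finite_inc_trees) (auto intro: finite_subset)
  have "(\<Sum>E\<in>inc_trees (insert m U). g E) =
      (\<Sum>x\<in>(SIGMA A:{A. A \<subseteq> U \<and> Max U \<in> A}. inc_trees A \<times> inc_trees (U - A)).
         g ((\<lambda>(A, E1, E2). graft m A (U - A) E1 E2) x))"
    by (rule sum.reindex_bij_betw[OF bij_betw_graft, symmetric])
  also have "\<dots> = (\<Sum>A | A \<subseteq> U \<and> Max U \<in> A. \<Sum>(E1, E2)\<in>inc_trees A \<times> inc_trees (U - A).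
      g (graft m A (U - A) E1 E2))"
    using fin finA by (subst sum.Sigma) (auto simp: split_def)
  also have "\<dots> = (\<Sum>A | A \<subseteq> U \<and> Max U \<in> A.
    \<Sum>E1\<in>inc_trees A. \<Sum>E2\<in>inc_trees (U - A). g (graft m A (U - A) E1 E2))"
    by (simp add: sum.cartesian_product)
  finally show ?thesis .
qed

end

subsection \<open>Recurrences\<close>

lemma sum_Pow_card:
  fixes G :: "nat \<Rightarrow> nat"
  assumes "finite W"
  shows "(\<Sum>A\<in>Pow W. G (card A)) = (\<Sum>j\<le>card W. (card W choose j) * G j)"
proof -
  have "(\<Sum>A\<in>Pow W. G (card A)) = (\<Sum>j\<le>card W. \<Sum>A\<in>{A \<in> Pow W. card A = j}. G (card A))"
    using assms by (intro sum.group[symmetric]) (auto intro: card_mono)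
  also have "\<dots> = (\<Sum>j\<le>card W. (card W choose j) * G j)"
  proof (rule sum.cong)
    fix j
    have "(\<Sum>A\<in>{A \<in> Pow W. card A = j}. G (card A)) = card {A. A \<subseteq> W \<and> card A = j} * G j"
      by simp
    then show "(\<Sum>A\<in>{A \<in> Pow W. card A = j}. G (card A)) = (card W choose j) * G j"
      by (simp only: n_subsets[OF assms])
  qed simp
  finally show ?thesis .
qed

text \<open>Subsets containing \<open>a\<close> correspond to arbitrary subsets of the other
  \<open>n\<close> elements; \<open>j\<close> is the size of the latter.\<close>

lemma sum_subsets_containing:
  fixes F :: "nat \<Rightarrow> nat \<Rightarrow> nat"
  assumes "finite U" "a \<in> U" "card U = Suc n"
  shows "(\<Sum>A | A \<subseteq> U \<and> a \<in> A. F (card A) (card (U - A)))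
    = (\<Sum>j\<le>n. (n choose j) * F (Suc j) (n - j))"
proof -
  let ?W = "U - {a}"
  have W: "finite ?W" "card ?W = n" using assms by auto
  have "(\<Sum>A | A \<subseteq> U \<and> a \<in> A. F (card A) (card (U - A)))
      = (\<Sum>A\<in>Pow ?W. F (card (insert a A)) (card (U - insert a A)))"
    by (rule sum.reindex_bij_witness[of _ "insert a" "\<lambda>A. A - {a}"])
       (use assms(2) in \<open>auto simp: insert_absorb\<close>)
  also have "\<dots> = (\<Sum>A\<in>Pow ?W. F (Suc (card A)) (n - card A))"
  proof (rule sum.cong)
    fix A assume A: "A \<in> Pow ?W"
    then have "finite A" "a \<notin> A" using W(1) by (auto intro: finite_subset)
    moreover have "card (U - insert a A) = n - card A"
    proof -
      have "U - insert a A = ?W - A" by blast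
      then show ?thesis using A W \<open>finite A\<close> by (simp add: card_Diff_subset)
    qed
    ultimately show "F (card (insert a A)) (card (U - insert a A)) = F (Suc (card A)) (n - card A)"
      by simp
  qed simp
  also have "\<dots> = (\<Sum>j\<le>n. (n choose j) * F (Suc j) (n - j))"
    using sum_Pow_card[OF W(1), of "\<lambda>j. F (Suc j) (n - j)"] W(2) by simp
  finally show ?thesis .
qed

lemma tree_count_0 [simp]: "tree_count 0 = 1"
  by (simp add: tree_count_def inc_trees_empty)

lemma tree_count_1 [simp]: "tree_count (Suc 0) = 1"
  by (simp add: tree_count_def inc_trees_singleton lessThan_Suc)

lemma pair_count_0 [simp]: "pair_count K i 0 = 0"
  by (simp add: pair_count_def inc_trees_empty count_vertices_def)

text \<open>The rank enters only through \<open>root_rank_count\<close>, in the same form as in the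
  recurrence for larger trees, so no rank has to be computed.\<close>

lemma pair_count_1: "pair_count K i (Suc 0) = (if i = 1 then root_rank_count K 1 else 0)"
proof -
  have sub: "subtree_vertices {} (0 :: nat) = {0}" by (auto simp: subtree_vertices_def)
  have "count_vertices K i {0} {} = card (if vertex_rank {} (0 :: nat) \<in> K \<and> i = 1 then {0 :: nat} else {})"
    unfolding count_vertices_def by (rule arg_cong[of _ _ card]) (auto simp: sub)
  then have "pair_count K i (Suc 0) = (if vertex_rank {} (0 :: nat) \<in> K \<and> i = 1 then 1 else 0)"
    by (simp add: pair_count_def inc_trees_singleton lessThan_Suc)
  moreover have "root_rank_count K (Suc 0)
      = card (if vertex_rank {} (0 :: nat) \<in> K then {{} :: (nat \<times> nat) set} else {})"
    unfolding root_rank_count_def by (rule arg_cong[of _ _ card]) (auto simp: inc_trees_singleton lessThan_Suc)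
  ultimately show ?thesis by simp
qed

context
  fixes n :: nat
begin

private abbreviation "U \<equiv> {..<Suc n}"

private lemma Max_U: "Max U = n"
  by (intro Max_eqI) auto

private lemma insert_U: "{..<Suc (Suc n)} = insert (Suc n) U"
  by auto

private lemma fin_subset: "A \<subseteq> U \<Longrightarrow> finite A" "finite (U - A)"
  by (auto intro: finite_subset)

text \<open>Here \<open>j\<close> is the number of vertices that accompany the second largest label
  in its branch. Singling out this branch replaces the usual symmetry factor 1/2.\<close>

lemma tree_count_Suc_Suc:
  "tree_count (Suc (Suc n)) = (\<Sum>j\<le>n. (n choose j) * (tree_count (Suc j) * tree_count (n - j)))"
proof -
  have "tree_count (Suc (Suc n)) = (\<Sum>E\<in>inc_trees (insert (Suc n) U). 1)"
    by (simp add: tree_count_def insert_U)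
  also have "\<dots> = (\<Sum>A | A \<subseteq> U \<and> Max U \<in> A. \<Sum>E1\<in>inc_trees A. \<Sum>E2\<in>inc_trees (U - A). 1)"
    by (rule sum_inc_trees_graft) auto
  also have "\<dots> = (\<Sum>A | A \<subseteq> U \<and> n \<in> A. tree_count (card A) * tree_count (card (U - A)))"
    unfolding Max_U by (intro sum.cong refl) (use fin_subset card_inc_trees in auto)
  also have "\<dots> = (\<Sum>j\<le>n. (n choose j) * (tree_count (Suc j) * tree_count (n - j)))"
    by (rule sum_subsets_containing) auto
  finally show ?thesis .
qed

text \<open>A vertex is the root or lies in exactly one branch; the root has the required size only
  if \<open>i\<close> is the total number \<open>n + 2\<close> of vertices.\<close>

lemma pair_count_Suc_Suc:
  "pair_count K i (Suc (Suc n)) = (if i = Suc (Suc n) then root_rank_count K i else 0) +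
     (\<Sum>j\<le>n. (n choose j) *
       (pair_count K i (Suc j) * tree_count (n - j) + tree_count (Suc j) * pair_count K i (n - j)))"
proof -
  let ?g = "\<lambda>E. if vertex_rank E (Suc n) \<in> K \<and> card (insert (Suc n) U) = i then 1 else 0 :: nat"
  let ?G = "\<lambda>A. graft (Suc n) A (U - A)"
  let ?c = "\<lambda>A. \<Sum>E1\<in>inc_trees A. \<Sum>E2\<in>inc_trees (U - A).
    count_vertices K i A E1 + count_vertices K i (U - A) E2"
  have "pair_count K i (Suc (Suc n))
      = (\<Sum>E\<in>inc_trees (insert (Suc n) U). count_vertices K i (insert (Suc n) U) E)"
    by (simp add: pair_count_def insert_U)
  also have "\<dots> = (\<Sum>A | A \<subseteq> U \<and> Max U \<in> A. \<Sum>E1\<in>inc_trees A. \<Sum>E2\<in>inc_trees (U - A).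
      count_vertices K i (insert (Suc n) U) (?G A E1 E2))"
    by (rule sum_inc_trees_graft) auto
  also have "\<dots> = (\<Sum>A | A \<subseteq> U \<and> Max U \<in> A. \<Sum>E1\<in>inc_trees A. \<Sum>E2\<in>inc_trees (U - A).
      ?g (?G A E1 E2) + (count_vertices K i A E1 + count_vertices K i (U - A) E2))"
  proof (intro sum.cong refl)
    fix A E1 E2 assume "A \<in> {A. A \<subseteq> U \<and> Max U \<in> A}" "E1 \<in> inc_trees A" "E2 \<in> inc_trees (U - A)"
    then show "count_vertices K i (insert (Suc n) U) (?G A E1 E2) =
        ?g (?G A E1 E2) + (count_vertices K i A E1 + count_vertices K i (U - A) E2)"
      by (subst count_vertices_graft) auto
  qed
  also have "\<dots> = (\<Sum>A | A \<subseteq> U \<and> Max U \<in> A. \<Sum>E1\<in>inc_trees A. \<Sum>E2\<in>inc_trees (U - A).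
      ?g (?G A E1 E2)) + (\<Sum>A | A \<subseteq> U \<and> Max U \<in> A. ?c A)"
    by (simp only: sum.distrib)
  \<comment> \<open>The rank of the root depends on both branches at once. These terms are therefore
    summed back over whole trees, where they count trees by root rank.\<close>
  also have "(\<Sum>A | A \<subseteq> U \<and> Max U \<in> A. \<Sum>E1\<in>inc_trees A. \<Sum>E2\<in>inc_trees (U - A).
      ?g (?G A E1 E2)) = (\<Sum>E\<in>inc_trees (insert (Suc n) U). ?g E)"
    by (rule sum_inc_trees_graft[symmetric]) auto
  also have "\<dots> = (if i = Suc (Suc n) then root_rank_count K i else 0)"
  proof -
    have Mx: "Max {..<Suc (Suc n)} = Suc n" by (intro Max_eqI) auto
    have card: "(\<Sum>E\<in>inc_trees {..<Suc (Suc n)}. if vertex_rank E (Suc n) \<in> K then 1 else 0)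
        = root_rank_count K (Suc (Suc n))"
      using sum.inter_filter[OF finite_inc_trees[of "{..<Suc (Suc n)}"],
          of "\<lambda>_. 1 :: nat" "\<lambda>E. vertex_rank E (Suc n) \<in> K"]
      unfolding root_rank_count_def Mx by simp
    show ?thesis
    proof (cases "i = Suc (Suc n)")
      case True
      then show ?thesis using card unfolding insert_U[symmetric] by simp
    qed (simp add: insert_U[symmetric])
  qed
  also have "(\<Sum>A | A \<subseteq> U \<and> Max U \<in> A. ?c A) = (\<Sum>A | A \<subseteq> U \<and> n \<in> A.
      pair_count K i (card A) * tree_count (card (U - A)) +
      tree_count (card A) * pair_count K i (card (U - A)))"
    unfolding Max_U
  proof (intro sum.cong refl)
    fix A assume "A \<in> {A. A \<subseteq> U \<and> n \<in> A}"
    then have fA: "finite A" using fin_subset(1) by blast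
    have "?c A = (\<Sum>E1\<in>inc_trees A. count_vertices K i A E1) * card (inc_trees (U - A)) +
        card (inc_trees A) * (\<Sum>E2\<in>inc_trees (U - A). count_vertices K i (U - A) E2)"
      by (simp add: sum.distrib sum_distrib_left mult.commute)
    then show "?c A = pair_count K i (card A) * tree_count (card (U - A)) +
        tree_count (card A) * pair_count K i (card (U - A))"
      using sum_count_vertices[OF fA] sum_count_vertices[OF fin_subset(2)]
        card_inc_trees[OF fA] card_inc_trees[OF fin_subset(2)] by simp
  qed
  also have "\<dots> = (\<Sum>j\<le>n. (n choose j) *
       (pair_count K i (Suc j) * tree_count (n - j) + tree_count (Suc j) * pair_count K i (n - j)))"
    by (rule sum_subsets_containing[where
          F = "\<lambda>x y. pair_count K i x * tree_count y + tree_count x * pair_count K i y"]) auto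
  finally show ?thesis .
qed

end

lemma root_rank_count_UNIV: "root_rank_count UNIV n = tree_count n"
  by (simp add: root_rank_count_def tree_count_def)

lemma tree_count_pos: "tree_count n > 0"
proof (induction n rule: less_induct)
  case (less n)
  consider "n = 0" | "n = 1" | m where "n = Suc (Suc m)" by (metis One_nat_def not0_implies_Suc)
  then show ?case
  proof cases
    case 3
    \<comment> \<open>The term \<open>j = 0\<close>, where the second largest label forms a branch
      of its own, is already positive.\<close>
    have "0 < (m choose 0) * (tree_count (Suc 0) * tree_count (m - 0))" using less 3 by simp
    also have "\<dots> \<le> tree_count n" unfolding 3 tree_count_Suc_Suc
      by (rule member_le_sum) auto
    finally show ?thesis .
  qed auto
qed

section \<open>Translation of counts into probabilities\<close>

lemma card_tree_vertex_pairs: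
  assumes "n \<ge> 1"
  shows "card (tree_vertex_pairs n) = tree_count n * n"
  using card_inc_trees[of "{1..n}"] 
  by (simp add: tree_vertex_pairs_def trees12_eq_inc_trees[OF assms] card_cartesian_product)

lemma card_tree_vertex_pairs_rank_size:
  assumes "n \<ge> 1"
  shows "card (tree_vertex_pairs n \<inter> {(T, v). vertex_rank T v \<in> K \<and> card (subtree_vertices T v) = i})
    = pair_count K i n"
proof -
  have "tree_vertex_pairs n \<inter> {(T, v). vertex_rank T v \<in> K \<and> card (subtree_vertices T v) = i}
      = (SIGMA T:inc_trees {1..n}.
          {v \<in> {1..n}. vertex_rank T v \<in> K \<and> card (subtree_vertices T v) = i})"
    unfolding tree_vertex_pairs_def trees12_eq_inc_trees[OF assms] by auto
  then have "card (tree_vertex_pairs n \<inter>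
        {(T, v). vertex_rank T v \<in> K \<and> card (subtree_vertices T v) = i})
      = (\<Sum>T\<in>inc_trees {1..n}. count_vertices K i {1..n} T)"
    using finite_inc_trees[of "{1..n}"] by (simp add: count_vertices_def)
  then show ?thesis using sum_count_vertices[of "{1..n}"] by simp
qed

text \<open>Agrees with the probability for \<open>n \<ge> 1\<close>; at \<open>n = 0\<close> there
  is no pair to draw and the quotient is 0 by convention.\<close>

definition rank_size_prob_in :: "nat set \<Rightarrow> nat \<Rightarrow> nat \<Rightarrow> real" where
  "rank_size_prob_in K n i = real (pair_count K i n) / (real (tree_count n) * real n)"

lemma prob_rank_size:
  assumes "n \<ge> 1"
  shows "measure_pmf.prob (pmf_of_set (tree_vertex_pairs n))
      {(T, v). vertex_rank T v \<in> K \<and> card (subtree_vertices T v) = i} = rank_size_prob_in K n i"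
  using measure_pmf_of_set[OF tree_vertex_pairs_nonempty[OF assms] finite_tree_vertex_pairs]
  by (simp add: rank_size_prob_in_def card_tree_vertex_pairs[OF assms]
      card_tree_vertex_pairs_rank_size[OF assms])

lemma card_subtree_bounds:
  assumes "T \<in> inc_trees {1..n}" "v \<in> {1..n}"
  shows "card (subtree_vertices T v) \<in> {1..n}"
proof -
  have sub: "subtree_vertices T v \<subseteq> {1..n}"
  proof
    fix u assume "u \<in> subtree_vertices T v"
    then have "(u, v) \<in> T\<^sup>*" by (simp add: subtree_vertices_def)
    then show "u \<in> {1..n}" using assms(2) inc_treesD(1)[OF assms(1)]
      by (induction rule: converse_rtrancl_induct) blast+
  qed
  moreover have "v \<in> subtree_vertices T v" by (simp add: subtree_vertices_def)
  ultimately have "0 < card (subtree_vertices T v)" using finite_subset card_gt_0_iff by blast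
  moreover have "card (subtree_vertices T v) \<le> card {1..n}" using sub by (intro card_mono) auto
  ultimately show ?thesis by simp
qed

text \<open>The event is split by subtree size; sizes run from 1 to \<open>n\<close> and are written
  \<open>Suc i\<close> with \<open>i < n\<close>.\<close>

lemma prob_rank:
  assumes n: "n \<ge> 1"
  shows "measure_pmf.prob (pmf_of_set (tree_vertex_pairs n)) {(T, v). vertex_rank T v \<in> K}
    = (\<Sum>i<n. rank_size_prob_in K n (Suc i))"
proof -
  let ?P = "\<lambda>A. measure_pmf.prob (pmf_of_set (tree_vertex_pairs n)) A"
  let ?S = "\<lambda>i. {(T, v). vertex_rank T v \<in> K \<and> card (subtree_vertices T v) = Suc i}"
  have "?P {(T, v). vertex_rank T v \<in> K} = ?P (\<Union>i<n. ?S i)"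
  proof (rule measure_pmf.finite_measure_eq_AE)
    show "AE x in measure_pmf (pmf_of_set (tree_vertex_pairs n)).
        (x \<in> {(T, v). vertex_rank T v \<in> K}) = (x \<in> (\<Union>i<n. ?S i))"
      unfolding AE_measure_pmf_iff set_pmf_of_set[OF tree_vertex_pairs_nonempty[OF n] finite_tree_vertex_pairs]
    proof
      fix x assume "x \<in> tree_vertex_pairs n"
      then obtain T v where x: "x = (T, v)" "T \<in> inc_trees {1..n}" "v \<in> {1..n}"
        by (auto simp: tree_vertex_pairs_def trees12_eq_inc_trees[OF n])
      have "\<exists>i<n. card (subtree_vertices T v) = Suc i"
        using card_subtree_bounds[OF x(2,3)]
        by (intro exI[of _ "card (subtree_vertices T v) - 1"]) auto
      then show "(x \<in> {(T, v). vertex_rank T v \<in> K}) = (x \<in> (\<Union>i<n. ?S i))"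
        using x(1) by auto
    qed
  qed auto
  also have "\<dots> = (\<Sum>i<n. ?P (?S i))"
    by (rule measure_pmf.finite_measure_finite_Union) (auto simp: disjoint_family_on_def)
  also have "\<dots> = (\<Sum>i<n. rank_size_prob_in K n (Suc i))"
    using prob_rank_size[OF n] by simp
  finally show ?thesis .
qed

subsection \<open>Exponential generating functions\<close>

text \<open>Polymorphic in the field: the equations for pairs are used over the reals, the analysis
  of the pole over the complex numbers.\<close>

definition egf :: "(nat \<Rightarrow> nat) \<Rightarrow> 'a :: field_char_0 fps" where
  "egf a = Abs_fps (\<lambda>n. of_nat (a n) / fact n)"

lemma egf_nth [simp]: "fps_nth (egf a) n = of_nat (a n) / fact n"
  by (simp add: egf_def)

lemma egf_deriv: "fps_deriv (egf a) = egf (\<lambda>n. a (Suc n))"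
  by (rule fps_ext) (simp add: fact_Suc divide_simps del: of_nat_Suc)

lemma egf_add: "egf a + egf b = egf (\<lambda>n. a n + b n)"
  by (rule fps_ext) (simp add: add_divide_distrib)

lemma egf_mult: "egf a * egf b = egf (\<lambda>n. \<Sum>j\<le>n. (n choose j) * (a j * b (n - j)))"
proof (rule fps_ext)
  fix n
  have "fps_nth (egf a * egf b :: 'a fps) n
      = (\<Sum>j\<le>n. of_nat (a j) / fact j * (of_nat (b (n - j)) / fact (n - j)))"
    by (simp add: fps_mult_nth atLeast0AtMost)
  also have "\<dots> = (\<Sum>j\<le>n. of_nat ((n choose j) * (a j * b (n - j))) / fact n)"
  proof (rule sum.cong)
    fix j assume "j \<in> {..n}"
    then have "(of_nat (n choose j) :: 'a) = fact n / (fact j * fact (n - j))"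
      by (simp add: binomial_fact)
    then show "of_nat (a j) / fact j * (of_nat (b (n - j)) / fact (n - j))
        = (of_nat ((n choose j) * (a j * b (n - j))) / fact n :: 'a)"
      by (simp add: field_simps)
  qed simp
  finally show "fps_nth (egf a * egf b) n
      = fps_nth (egf (\<lambda>n. \<Sum>j\<le>n. (n choose j) * (a j * b (n - j))) :: 'a fps) n"
    by (simp add: sum_divide_distrib)
qed

abbreviation tree_egf :: "'a :: field_char_0 fps" where
  "tree_egf \<equiv> egf tree_count"

lemma tree_egf_deriv2: "fps_deriv (fps_deriv tree_egf) = fps_deriv tree_egf * tree_egf"
  unfolding egf_deriv egf_mult tree_count_Suc_Suc ..

lemma fps_sin_nth_0: "fps_nth (fps_sin c) 0 = 0"
  by (simp add: fps_sin_def)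

text \<open>The equation y'' = y'y integrates to 2y' = y^2 + 1. Hence w = 1/y' satisfies w' = -yw
  and w'' = 1 - w, so 1 - w is the sine, and yw = -w' is the cosine.\<close>

lemma tree_egf_eq:
  shows "fps_deriv tree_egf * (1 - fps_sin 1) = (1 :: 'a :: field_char_0 fps)"
    and "tree_egf * (1 - fps_sin 1) = (fps_cos 1 :: 'a :: field_char_0 fps)"
proof -
  define Y :: "'a fps" where "Y = tree_egf"
  define D where "D = fps_deriv Y"
  define w where "w = inverse D"
  have D0: "fps_nth D 0 = 1" by (simp add: D_def Y_def)
  have w0: "fps_nth w 0 = 1" by (simp add: w_def D0)
  have Dw: "D * w = 1" unfolding w_def using D0 by (intro inverse_mult_eq_1') simp
  have D': "fps_deriv D = D * Y" unfolding D_def Y_def by (rule tree_egf_deriv2)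
  have w': "fps_deriv w = - (Y * w)"
  proof -
    have "D * fps_deriv w + fps_deriv D * w = 0" using arg_cong[OF Dw, of fps_deriv] by simp
    then have "D * fps_deriv w = - (D * Y * w)" using D' by (simp add: eq_neg_iff_add_eq_0)
    then have "w * (D * fps_deriv w) = w * (- (D * Y * w))" by simp
    then have "(D * w) * fps_deriv w = (D * w) * (- (Y * w))" by (simp add: algebra_simps)
    then show ?thesis using Dw by simp
  qed
  have YY: "Y * Y = 2 * D - 1"
  proof -
    \<comment> \<open>Integration of y'' = y'y; the constant comes from y(0) = y'(0) = 1.\<close>
    have "fps_deriv (2 * D - Y * Y) = fps_deriv 1" by (simp add: D' D_def[symmetric] algebra_simps)
    then have "2 * D - Y * Y = fps_const (fps_nth (2 * D - Y * Y) 0 - fps_nth 1 0) + 1"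
      by (simp only: fps_deriv_eq_iff)
    moreover have "fps_nth (2 * D - Y * Y) 0 = 1" by (simp add: D0 Y_def)
    ultimately show ?thesis by (simp add: algebra_simps)
  qed
  have w'': "fps_deriv (fps_deriv w) = 1 - w"
  proof -
    have "fps_deriv (fps_deriv w) = - (D * w) + Y * Y * w"
      unfolding w' by (simp add: w' D_def[symmetric] algebra_simps)
    also have "\<dots> = - (D * w) + (2 * (D * w) - w)" unfolding YY by (simp add: algebra_simps)
    finally show ?thesis by (simp add: Dw)
  qed
  \<comment> \<open>\<open>1 - w\<close> has initial values 0 and 1 and second derivative
    \<open>- (1 - w)\<close>, which characterises the sine.\<close>
  have "fps_sin 1 = 1 - w"
  proof (rule eq_fps_sin)
    have "fps_nth (fps_deriv w) 0 = - 1" unfolding w' using w0 by (simp add: Y_def)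
    then show "fps_nth (1 - w) 1 = 1" by simp
    show "fps_deriv (fps_deriv (1 - w)) = - (fps_const 1 * fps_const 1 * (1 - w))" using w'' by simp
  qed (simp add: w0)
  then have w: "w = 1 - fps_sin 1" by simp
  show "fps_deriv tree_egf * (1 - fps_sin 1) = (1 :: 'a fps)"
    using Dw unfolding w D_def Y_def .
  have "Y * w = - fps_deriv (1 - fps_sin 1)" unfolding w[symmetric] w' by simp
  then show "tree_egf * (1 - fps_sin 1) = (fps_cos 1 :: 'a fps)"
    unfolding w Y_def by (simp add: fps_sin_deriv)
qed

section \<open>The pole at \<pi>/2 and the growth of the tree counts\<close>

definition sinc :: "complex \<Rightarrow> complex" where
  "sinc z = (if z = 0 then 1 else sin z / z)"

lemma holomorphic_sinc: "sinc holomorphic_on A"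
proof -
  \<comment> \<open>\<open>sinc\<close> is the difference quotient of \<open>sin\<close> at 0
    completed by the derivative there; removing the singularity makes it entire.\<close>
  have "(\<lambda>z. if z = 0 then deriv sin 0 else (sin z - sin 0) / (z - 0)) holomorphic_on (UNIV :: complex set)"
    by (rule pole_lemma) (auto intro: holomorphic_intros)
  moreover have "deriv sin (0 :: complex) = 1"
    using DERIV_imp_deriv[OF DERIV_sin[of "0 :: complex"]] by simp
  ultimately have "sinc holomorphic_on UNIV" by (simp add: sinc_def[abs_def] cong: if_cong)
  then show ?thesis by (rule holomorphic_on_subset) simp
qed

text \<open>Zeros of the sine are integer multiples of \<pi>, and the zero at 0 has been divided
  out.\<close>

lemma sinc_nonzero:
  assumes "norm z < pi"
  shows "sinc z \<noteq> 0"
proof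
  assume "sinc z = 0"
  then have z: "z \<noteq> 0" "sin z = 0" by (auto simp: sinc_def split: if_splits)
  then obtain n :: int where n: "z = of_real (of_int n * pi)" by (auto simp: sin_eq_0)
  then have "norm z = \<bar>real_of_int n\<bar> * pi" by (simp add: norm_mult abs_mult)
  moreover have "n \<noteq> 0" using n z by auto
  then have "1 * pi \<le> \<bar>real_of_int n\<bar> * pi" by (intro mult_right_mono) auto
  ultimately show False using assms by simp
qed

text \<open>Multiplying y = cos z / (1 - sin z) by \<open>a - z\<close>, with \<open>a\<close> the
  point \<pi>/2, cancels the simple pole; the product extends to \<open>u\<close>, holomorphic in
  the disc of radius 3\<pi>/2, so its series converges at \<open>a\<close> to
  \<open>u a = 2\<close>. The partial sums of that series at \<open>a\<close> telescope to the
  sequence in question.\<close>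

lemma tree_count_asymp: "(\<lambda>n. real (tree_count n) / fact n * (pi / 2) ^ Suc n) \<longlonglongrightarrow> 2"
proof -
  define a :: complex where "a = of_real (pi / 2)"
  \<comment> \<open>With x = (a - z)/2 one has cos z = 2 sin x cos x and 1 - sin z = 2 (sin x)^2, so
    the product is 2x cos x / sin x. For z of norm below 3\<pi>/2 the argument x stays in the disc
    of radius \<pi>, where \<open>sinc\<close> has no zero.\<close>
  define u where "u z = 2 * cos ((a - z) / 2) / sinc ((a - z) / 2)" for z
  define U :: "complex fps" where "U = (fps_const a - fps_X) * tree_egf"
  have small: "norm ((a - z) / 2) < pi" if "norm z < 3 * pi / 2" for z
  proof -
    have "norm (a - z) \<le> norm a + norm z" by (rule norm_triangle_ineq4)
    moreover have "norm a = pi / 2" unfolding a_def norm_of_real by simp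
    ultimately show ?thesis using that by (simp add: norm_divide)
  qed
  have holo: "u holomorphic_on ball 0 (3 * pi / 2)"
  proof -
    have "(sinc \<circ> (\<lambda>z. (a - z) / 2)) holomorphic_on ball 0 (3 * pi / 2)"
      by (rule holomorphic_on_compose[OF _ holomorphic_sinc]) (auto intro!: holomorphic_intros)
    then have "(\<lambda>z. sinc ((a - z) / 2)) holomorphic_on ball 0 (3 * pi / 2)" by (simp add: o_def)
    then show ?thesis unfolding u_def[abs_def]
      by (intro holomorphic_intros) (use small sinc_nonzero in auto)
  qed
  have u_eq: "u z = (a - z) * (cos z / (1 - sin z))" if "norm z < pi / 2" for z
  proof -
    define x where "x = (a - z) / 2"
    have zx: "z = of_real pi / 2 - 2 * x" by (simp add: x_def a_def field_simps)
    have x0: "x \<noteq> 0"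
    proof
      assume "x = 0"
      then have "norm z = pi / 2" by (simp add: zx norm_divide)
      then show False using that by simp
    qed
    have "norm x < pi" unfolding x_def using that pi_gt_zero by (intro small) linarith
    then have s: "sin x \<noteq> 0" using sinc_nonzero[of x] x0 by (auto simp: sinc_def)
    have "cos z = sin (2 * x)" unfolding zx by (simp add: cos_diff)
    then have c: "cos z = 2 * sin x * cos x" by (simp add: sin_double)
    have "sin z = cos (2 * x)" unfolding zx by (simp add: sin_diff)
    then have "sin z = 1 - 2 * (sin x)\<^sup>2" by (simp add: cos_double_sin)
    then have "1 - sin z = 2 * sin x * sin x" by (simp add: power2_eq_square)
    then have "(a - z) * (cos z / (1 - sin z)) = 2 * x * (2 * sin x * cos x / (2 * sin x * sin x))"
      using c by (simp add: x_def)
    also have "\<dots> = u z" unfolding u_def x_def[symmetric] sinc_def using x0 s by (simp add: field_simps)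
    finally show ?thesis ..
  qed
  have "(\<lambda>z. (a - z) * (cos z / (1 - sin z))) has_fps_expansion
      ((fps_const a - fps_X) * (fps_cos 1 / (1 - fps_sin 1)))"
    by (intro fps_expansion_intros) (simp add: fps_sin_nth_0)
  moreover have "fps_cos 1 / (1 - fps_sin 1) = (tree_egf :: complex fps)"
  proof -
    have "fps_nth (1 - fps_sin 1 :: complex fps) 0 \<noteq> 0" by (simp add: fps_sin_nth_0)
    then have "(1 - fps_sin 1 :: complex fps) \<noteq> 0" by (metis fps_zero_nth)
    then show ?thesis unfolding tree_egf_eq(2)[symmetric] by simp
  qed
  moreover have "\<forall>\<^sub>F z in nhds 0. (a - z) * (cos z / (1 - sin z)) = u z"
    using u_eq by (intro eventually_nhds_in_open[THEN eventually_mono, of "ball 0 (pi / 2)"]) auto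
  ultimately have "u has_fps_expansion U"
    unfolding U_def using has_fps_expansion_cong by force
  then have U: "fps_expansion u 0 = U" by (rule fps_expansion_eqI)
  have "(\<lambda>n. fps_nth U n * a ^ n) sums u a"
  proof -
    have h: "u holomorphic_on eball 0 (ereal (3 * pi / 2))" using holo by simp
    have na: "norm a < 3 * pi / 2" unfolding a_def norm_of_real using pi_gt_zero by simp
    have "ereal (norm a) < fps_conv_radius U"
      using conv_radius_fps_expansion[OF h] na unfolding U by (meson less_ereal.simps(1) less_le_trans)
    then have "(\<lambda>n. fps_nth U n * a ^ n) sums eval_fps U a" by (rule sums_eval_fps)
    moreover have "eval_fps U a = u a" using eval_fps_expansion'[OF h, of a] na unfolding U by simp
    ultimately show ?thesis by simp
  qed
  moreover have "u a = 2" by (simp add: u_def sinc_def)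
  ultimately have "(\<lambda>n. \<Sum>j\<le>n. fps_nth U j * a ^ j) \<longlonglongrightarrow> 2"
    by (simp add: sums_def_le)
  moreover have "(\<Sum>j\<le>n. fps_nth U j * a ^ j)
      = of_real (real (tree_count n) / fact n * (pi / 2) ^ Suc n)" for n
  proof -
    \<comment> \<open>For j > 0 the term is y_j a^(j+1) - y_(j-1) a^j, with y_j the coefficients of
      \<open>tree_egf\<close>; hence the telescoping.\<close>
    have "(\<Sum>j\<le>n. fps_nth U j * a ^ j) = fps_nth tree_egf n * a ^ Suc n"
    proof (induction n)
      case 0
      then show ?case by (simp add: U_def algebra_simps)
    next
      case (Suc n)
      have U_Suc: "fps_nth U (Suc n) = a * fps_nth tree_egf (Suc n) - fps_nth tree_egf n"
        unfolding U_def by (simp add: algebra_simps del: egf_nth)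
      show ?case unfolding sum.atMost_Suc Suc.IH U_Suc by (simp add: algebra_simps del: egf_nth)
    qed
    then show ?thesis by (simp add: a_def)
  qed
  ultimately have "(\<lambda>n. complex_of_real (real (tree_count n) / fact n * (pi / 2) ^ Suc n))
      \<longlonglongrightarrow> complex_of_real 2" by simp
  then show ?thesis by (simp only: tendsto_of_real_iff)
qed

subsection \<open>Limits of the size probabilities\<close>

text \<open>The series G of the introductory comment for subtree size \<open>Suc i\<close>; the
  index is shifted by one.\<close>

definition hole_fps :: "nat \<Rightarrow> real fps" where
  "hole_fps i = fps_integral0 ((1 - fps_sin 1) * (fps_const (1 / fact i) * fps_X ^ i))"

lemma hole_fps_deriv: "fps_deriv (hole_fps i) = (1 - fps_sin 1) * (fps_const (1 / fact i) * fps_X ^ i)"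
  by (simp add: hole_fps_def fps_deriv_fps_integral)

lemma fps_deriv_eqD:
  fixes f g :: "'a :: {ring_1_no_zero_divisors, semiring_char_0} fps"
  assumes "fps_deriv f = fps_deriv g" "fps_nth f 0 = fps_nth g 0"
  shows "f = g"
  using assms(1) unfolding fps_deriv_eq_iff assms(2) by simp

text \<open>The recurrence for pairs becomes P'' = (YP)' + rM', which integrates to P' = YP + rM.
  The integrating factor is w = 1 - sin x = 1/Y': since w' = -Yw, the term YP cancels in (Pw)' and
  leaves rMw.\<close>

lemma pair_egf:
  fixes K i r defines "r \<equiv> real (root_rank_count K (Suc i))"
  shows "egf (pair_count K (Suc i)) = fps_const r * (hole_fps i * fps_deriv tree_egf)"
proof -
  define P :: "real fps" where "P = egf (pair_count K (Suc i))"
  define Y :: "real fps" where "Y = tree_egf"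
  define w :: "real fps" where "w = 1 - fps_sin 1"
  define M :: "real fps" where "M = fps_const (1 / fact i) * fps_X ^ i"
  have Yw: "Y * w = fps_cos 1" and Dw: "fps_deriv Y * w = 1"
    unfolding Y_def w_def by (rule tree_egf_eq)+
  have w': "fps_deriv w = - (Y * w)" unfolding Yw by (simp add: w_def fps_sin_deriv)
  have rM': "fps_deriv (fps_const r * M)
      = egf (\<lambda>n. if Suc i = Suc (Suc n) then root_rank_count K (Suc i) else 0)"
  proof (rule fps_ext)
    fix n show "fps_nth (fps_deriv (fps_const r * M)) n
      = fps_nth (egf (\<lambda>n. if Suc i = Suc (Suc n) then root_rank_count K (Suc i) else 0)) n"
      by (auto simp: M_def r_def field_simps simp del: of_nat_Suc)
  qed
  have "fps_deriv (fps_deriv P) = fps_deriv (fps_const r * M) + (fps_deriv P * Y + fps_deriv Y * P)"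
    unfolding rM' P_def Y_def egf_deriv egf_mult egf_add pair_count_Suc_Suc
    by (simp add: distrib_left sum.distrib)
  also have "\<dots> = fps_deriv (Y * P + fps_const r * M)" by (simp add: algebra_simps)
  \<comment> \<open>Both sides agree at 0: a single vertex has a subtree of size
    \<open>Suc i\<close> only for \<open>i = 0\<close>, and exactly then \<open>M\<close> has
    constant term 1.\<close>
  finally have P': "fps_deriv P = Y * P + fps_const r * M"
    by (rule fps_deriv_eqD) (auto simp: P_def Y_def M_def r_def pair_count_1)
  have "fps_deriv (P * w) = fps_deriv (fps_const r * hole_fps i)"
    unfolding fps_deriv_mult w' P' fps_deriv_mult_const_left hole_fps_deriv w_def[symmetric]
      M_def[symmetric] by (simp add: algebra_simps)
  then have "P * w = fps_const r * hole_fps i"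
    by (rule fps_deriv_eqD) (simp add: P_def hole_fps_def)
  then have "P * w * fps_deriv Y = fps_const r * hole_fps i * fps_deriv Y" by simp
  moreover have "P * w * fps_deriv Y = P * (fps_deriv Y * w)" by (simp only: ac_simps)
  ultimately have "P = fps_const r * hole_fps i * fps_deriv Y" unfolding Dw by simp
  then show ?thesis unfolding P_def Y_def by (simp only: mult.assoc)
qed

section \<open>Growth of the coefficients of y' and passage to the limit\<close>

abbreviation deriv_coeff :: "nat \<Rightarrow> real" where
  "deriv_coeff n \<equiv> real (tree_count (Suc n)) / fact n"

lemma deriv_coeff_eq: "fps_nth (fps_deriv tree_egf) n = deriv_coeff n"
  by (simp add: egf_deriv)

lemma deriv_coeff_pos: "deriv_coeff n > 0"
  using tree_count_pos[of "Suc n"] by simp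

text \<open>The denominator \<open>tree_count n * n\<close> equals
  \<open>fact n * deriv_coeff (n - 1)\<close>, so the coefficient of the product in
  \<open>pair_egf\<close> turns into a sum over ratios of coefficients.\<close>

lemma rank_size_prob_in_eq:
  assumes "n \<ge> 1"
  shows "rank_size_prob_in K n (Suc i) = real (root_rank_count K (Suc i)) *
    (\<Sum>j\<le>n. fps_nth (hole_fps i) j * deriv_coeff (n - j) / deriv_coeff (n - 1))"
proof -
  obtain m where m: "n = Suc m" using assms by (cases n) auto
  have "real (pair_count K (Suc i) n) / fact n = fps_nth (egf (pair_count K (Suc i))) n" by simp
  also have "\<dots> = real (root_rank_count K (Suc i)) * (\<Sum>j\<le>n. fps_nth (hole_fps i) j * deriv_coeff (n - j))"
    unfolding pair_egf fps_mult_left_const_nth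
    by (simp only: fps_mult_nth[of "hole_fps i"] deriv_coeff_eq atLeast0AtMost)
  finally have "real (pair_count K (Suc i) n) / fact n / deriv_coeff (n - 1)
      = real (root_rank_count K (Suc i)) *
        ((\<Sum>j\<le>n. fps_nth (hole_fps i) j * deriv_coeff (n - j)) / deriv_coeff (n - 1))" by simp
  moreover have "rank_size_prob_in K n (Suc i) = real (pair_count K (Suc i) n) / fact n / deriv_coeff (n - 1)"
    unfolding rank_size_prob_in_def m by (simp add: fact_Suc mult.commute del: of_nat_Suc)
  ultimately show ?thesis by (simp only: sum_divide_distrib)
qed

text \<open>The coefficient of y' at \<open>n\<close> is \<open>n + 1\<close> times that of y at
  \<open>n + 1\<close>; the factor \<open>Suc n\<close> reflects the double pole.\<close>

lemma deriv_coeff_asymp: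
  "(\<lambda>n. deriv_coeff n * (pi / 2) ^ n / real (Suc n)) \<longlonglongrightarrow> 2 / (pi / 2)\<^sup>2"
proof -
  have "(\<lambda>n. real (tree_count (Suc n)) / fact (Suc n) * (pi / 2) ^ Suc (Suc n) / (pi / 2)\<^sup>2)
      \<longlonglongrightarrow> 2 / (pi / 2)\<^sup>2"
    by (intro tendsto_divide LIMSEQ_Suc[OF tree_count_asymp]) auto
  moreover have "real (tree_count (Suc n)) / fact (Suc n) * (pi / 2) ^ Suc (Suc n) / (pi / 2)\<^sup>2
      = deriv_coeff n * (pi / 2) ^ n / real (Suc n)" for n
    by (simp add: fact_Suc power2_eq_square del: of_nat_Suc)
  ultimately show ?thesis by simp
qed

text \<open>Bounds for every \<open>n\<close>, from which a dominating series is built: the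
  normalised coefficients are positive and converge to a positive limit, so they and their inverses
  are bounded.\<close>

lemma deriv_coeff_bounds:
  obtains c C where "0 < c" "0 < C"
    "\<And>n. c * real (Suc n) / (pi / 2) ^ n \<le> deriv_coeff n"
    "\<And>n. deriv_coeff n \<le> C * real (Suc n) / (pi / 2) ^ n"
proof -
  define e where "e n = deriv_coeff n * (pi / 2) ^ n / real (Suc n)" for n
  define l where "l = 2 / (pi / 2)\<^sup>2"
  have e_pos: "e n > 0" for n
    unfolding e_def by (intro divide_pos_pos mult_pos_pos deriv_coeff_pos) auto
  have l: "l > 0" unfolding l_def by simp
  have lim: "e \<longlonglongrightarrow> l" unfolding e_def[abs_def] l_def by (rule deriv_coeff_asymp)
  then have "Bseq e" by (intro convergent_imp_Bseq convergentI)
  then obtain C where C: "C > 0" "\<And>n. norm (e n) \<le> C" by (auto elim: BseqE)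
  have "(\<lambda>n. inverse (e n)) \<longlonglongrightarrow> inverse l" using lim l by (intro tendsto_inverse) auto
  then have "Bseq (\<lambda>n. inverse (e n))" by (intro convergent_imp_Bseq convergentI)
  then obtain B where B: "B > 0" "\<And>n. norm (inverse (e n)) \<le> B" by (auto elim: BseqE)
  have "1 / B \<le> e n" for n
  proof -
    have "inverse (e n) \<le> B" using B(2)[of n] e_pos[of n] by simp
    then show ?thesis using e_pos[of n] B(1) by (simp add: field_simps)
  qed
  moreover have "e n \<le> C" for n using C(2)[of n] by (simp add: abs_le_iff)
  ultimately show ?thesis using B(1) C(1)
    by (intro that[of "1 / B" C]) (simp_all add: e_def field_simps del: of_nat_Suc)
qed

text \<open>Integration shifts the coefficients and divides them by \<open>n + 1\<close>, so at
  radius \<open>r\<close> the terms grow by at most the factor \<open>r\<close>.\<close>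

lemma fps_conv_radius_integral0:
  fixes F :: "real fps"
  shows "fps_conv_radius (fps_integral0 F) \<ge> fps_conv_radius F"
  unfolding fps_conv_radius_def
proof (rule conv_radius_geI_ex)
  fix r :: real assume r: "0 < r" "ereal r < conv_radius (fps_nth F)"
  have "summable (\<lambda>n. fps_nth (fps_integral0 F) (Suc n) * r ^ Suc n)"
  proof (rule summable_comparison_test')
    show "summable (\<lambda>n. r * norm (fps_nth F n * r ^ n))"
      using r by (intro summable_mult abs_summable_in_conv_radius) auto
    fix n :: nat
    have "norm (fps_nth (fps_integral0 F) (Suc n) * r ^ Suc n)
        = (r * norm (fps_nth F n * r ^ n)) / real (Suc n)"
      using r(1) by (simp add: abs_mult field_simps del: of_nat_Suc)
    also have "\<dots> \<le> (r * norm (fps_nth F n * r ^ n)) / 1"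
      using r(1) by (intro divide_left_mono) auto
    finally show "norm (fps_nth (fps_integral0 F) (Suc n) * r ^ Suc n) \<le> r * norm (fps_nth F n * r ^ n)"
      by simp
  qed
  then have "summable (\<lambda>n. fps_nth (fps_integral0 F) n * r ^ n)"
    by (subst (asm) summable_Suc_iff)
  then show "\<exists>z::real. norm z = r \<and> summable (\<lambda>n. fps_nth (fps_integral0 F) n * z ^ n)"
    using r(1) by (intro exI[of _ r]) auto
qed

lemma hole_fps_conv_radius: "fps_conv_radius (hole_fps i) = \<infinity>"
proof -
  have s: "fps_conv_radius (1 - fps_sin 1 :: real fps) = \<infinity>"
    using fps_conv_radius_diff[of "1 :: real fps" "fps_sin 1"] by simp
  have "fps_conv_radius (fps_const (1 / fact i) * fps_X ^ i :: real fps) = \<infinity>"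
    using fps_conv_radius_mult[of "fps_const (1 / fact i :: real)" "fps_X ^ i"] by simp
  then have "fps_conv_radius ((1 - fps_sin 1) * (fps_const (1 / fact i) * fps_X ^ i) :: real fps) = \<infinity>"
    using fps_conv_radius_mult[of "1 - fps_sin 1 :: real fps" "fps_const (1 / fact i) * fps_X ^ i"] s
    by simp
  then show ?thesis
    unfolding hole_fps_def using fps_conv_radius_integral0
    by (metis ereal_infty_less_eq(1))
qed

text \<open>In \<open>rank_size_prob_in_eq\<close> the ratio
  \<open>deriv_coeff (n - j) / deriv_coeff (n - 1)\<close> tends to (\<pi>/2)^(j-1), which turns the
  sum into this value.\<close>

definition hole_limit :: "nat \<Rightarrow> real" where
  "hole_limit i = eval_fps (hole_fps i) (pi / 2) / (pi / 2)"

text \<open>Tannery's theorem applied to the sum in \<open>rank_size_prob_in_eq\<close>, padded with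
  zeros beyond \<open>n\<close>.\<close>

lemma rank_size_prob_in_tendsto:
  "(\<lambda>n. rank_size_prob_in K n (Suc i)) \<longlonglongrightarrow> real (root_rank_count K (Suc i)) * hole_limit i"
proof -
  define g where "g = fps_nth (hole_fps i)"
  define \<rho> :: real where "\<rho> = pi / 2"
  define e where "e n = deriv_coeff n * \<rho> ^ n / real (Suc n)" for n
  define a where "a j n = (if j \<le> n then g j * deriv_coeff (n - j) / deriv_coeff (n - 1) else 0)" for j n
  have \<rho>: "\<rho> > 0" by (simp add: \<rho>_def)
  have e_mult: "e n * real (Suc n) / \<rho> ^ n = deriv_coeff n" for n
    using \<rho> by (simp add: e_def del: of_nat_Suc)
  obtain c C where c: "0 < c" "0 < C" and lower: "\<And>n. c * real (Suc n) / \<rho> ^ n \<le> deriv_coeff n"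
    and upper: "\<And>n. deriv_coeff n \<le> C * real (Suc n) / \<rho> ^ n"
    using deriv_coeff_bounds unfolding \<rho>_def by blast
  \<comment> \<open>\<open>C / c\<close> comes from the two bounds, \<open>\<rho>\<close> in the
    denominator from the exponent \<open>j - 1\<close>, and 2 from n - j + 1 \<le> 2n.\<close>
  define B where "B j = norm (g j * \<rho> ^ j) * (2 * C / (c * \<rho>))" for j
  have lim: "(\<lambda>n. a j n) \<longlonglongrightarrow> g j * \<rho> ^ j / \<rho>" for j
  proof -
    have e: "e \<longlonglongrightarrow> 2 / \<rho>\<^sup>2" unfolding e_def[abs_def] \<rho>_def by (rule deriv_coeff_asymp)
    \<comment> \<open>Here \<open>n = m + Suc j\<close>, so \<open>n - j\<close> is
      \<open>m + 1\<close> and \<open>n - 1\<close> is \<open>m + j\<close>; no subtraction is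
      truncated.\<close>
    have "(\<lambda>m. e (m + 1) / e (m + j)) \<longlonglongrightarrow> (2 / \<rho>\<^sup>2) / (2 / \<rho>\<^sup>2)"
      using \<rho> by (intro tendsto_divide LIMSEQ_ignore_initial_segment e) auto
    moreover have "(\<lambda>m. real (Suc (m + 1)) / real (Suc (m + j))) \<longlonglongrightarrow> 1" by real_asymp
    ultimately have "(\<lambda>m. g j * (e (m + 1) / e (m + j) * (real (Suc (m + 1)) / real (Suc (m + j))) * (\<rho> ^ j / \<rho>)))
        \<longlonglongrightarrow> g j * ((2 / \<rho>\<^sup>2) / (2 / \<rho>\<^sup>2) * 1 * (\<rho> ^ j / \<rho>))"
      by (intro tendsto_mult tendsto_const)
    moreover have "g j * (e (m + 1) / e (m + j) * (real (Suc (m + 1)) / real (Suc (m + j))) * (\<rho> ^ j / \<rho>))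
        = a j (m + Suc j)" for m
    proof -
      have "e (m + 1) * real (Suc (m + 1)) / \<rho> ^ (m + 1) = deriv_coeff (m + 1)"
        "e (m + j) * real (Suc (m + j)) / \<rho> ^ (m + j) = deriv_coeff (m + j)"
        by (rule e_mult)+
      moreover have "e (m + 1) / e (m + j) * (real (Suc (m + 1)) / real (Suc (m + j))) * (\<rho> ^ j / \<rho>)
        = (e (m + 1) * real (Suc (m + 1)) / \<rho> ^ (m + 1)) / (e (m + j) * real (Suc (m + j)) / \<rho> ^ (m + j))"
        using \<rho> by (simp add: power_add mult_ac del: of_nat_Suc)
      ultimately show ?thesis by (simp add: a_def)
    qed
    ultimately have "(\<lambda>m. a j (m + Suc j)) \<longlonglongrightarrow> g j * \<rho> ^ j / \<rho>" using \<rho> by simp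
    then show ?thesis by (rule LIMSEQ_offset)
  qed
  have bound: "norm (a j n) \<le> B j" if "n \<ge> 1" for j n
  proof (cases "j \<le> n")
    case True
    obtain m where m: "n = Suc m" using \<open>n \<ge> 1\<close> by (cases n) auto
    have "deriv_coeff (n - j) / deriv_coeff (n - 1)
        \<le> (C * real (Suc (n - j)) / \<rho> ^ (n - j)) / (c * real (Suc (n - 1)) / \<rho> ^ (n - 1))"
    proof (rule frac_le)
      show "0 \<le> C * real (Suc (n - j)) / \<rho> ^ (n - j)" using c \<rho> by simp
      show "0 < c * real (Suc (n - 1)) / \<rho> ^ (n - 1)" using c \<rho> by simp
    qed (rule upper lower)+
    also have "\<dots> = (C / c) * (\<rho> ^ (n - 1) / \<rho> ^ (n - j)) * (real (Suc (n - j)) / real n)"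
      by (simp add: m mult_ac)
    also have "\<rho> ^ (n - 1) / \<rho> ^ (n - j) = \<rho> ^ j / \<rho>"
    proof -
      have "\<rho> ^ (n - 1) * \<rho> = \<rho> ^ (n - j) * \<rho> ^ j"
        using True unfolding power_add[symmetric] by (simp add: m)
      then show ?thesis using \<rho> by (simp add: frac_eq_eq mult_ac)
    qed
    also have "(C / c) * (\<rho> ^ j / \<rho>) * (real (Suc (n - j)) / real n) \<le> (C / c) * (\<rho> ^ j / \<rho>) * 2"
      using c \<rho> that by (intro mult_left_mono) (auto simp: field_simps)
    finally have "deriv_coeff (n - j) / deriv_coeff (n - 1) \<le> \<rho> ^ j * (2 * C / (c * \<rho>))"
      by (simp add: field_simps)
    then have "\<bar>g j\<bar> * (deriv_coeff (n - j) / deriv_coeff (n - 1)) \<le> \<bar>g j\<bar> * (\<rho> ^ j * (2 * C / (c * \<rho>)))"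
      by (intro mult_left_mono) auto
    then show ?thesis using True \<rho> by (simp add: a_def B_def abs_mult mult.assoc)
  next
    case False
    then show ?thesis using c \<rho> by (simp add: a_def B_def)
  qed
  \<comment> \<open>The radius of convergence of \<open>hole_fps i\<close> is infinite, so absolute
    convergence at \<rho> gives a summable majorant.\<close>
  have "summable (\<lambda>j. norm (g j * \<rho> ^ j))"
    unfolding g_def by (rule norm_summable_fps) (simp add: hole_fps_conv_radius)
  then have "summable B" unfolding B_def by (rule summable_mult2)
  moreover have "eventually (\<lambda>(j, n). norm (a j n) \<le> B j) (at_top \<times>\<^sub>F sequentially)"
    unfolding eventually_prod_filter
  proof (intro exI conjI allI impI)
    show "\<forall>\<^sub>F _ in (at_top :: nat filter). True" by simp
    show "\<forall>\<^sub>F n :: nat in sequentially. n \<ge> 1" by (rule eventually_ge_at_top)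
    show "case (j, n) of (j, n) \<Rightarrow> norm (a j n) \<le> B j" if "n \<ge> 1" for j n
      using bound[OF that] by simp
  qed
  ultimately have T: "(\<lambda>n. suminf (\<lambda>j. a j n)) \<longlonglongrightarrow> (\<Sum>j. g j * \<rho> ^ j / \<rho>)"
    using tannerys_theorem[OF lim] by fastforce
  have "(\<Sum>j. g j * \<rho> ^ j / \<rho>) = hole_limit i"
  proof -
    have "(\<lambda>j. g j * \<rho> ^ j) sums eval_fps (hole_fps i) \<rho>"
      unfolding g_def by (rule sums_eval_fps) (simp add: hole_fps_conv_radius)
    then have "(\<lambda>j. g j * \<rho> ^ j / \<rho>) sums (eval_fps (hole_fps i) \<rho> / \<rho>)" by (rule sums_divide)
    then show ?thesis unfolding hole_limit_def \<rho>_def[symmetric] by (rule sums_unique[symmetric])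
  qed
  moreover have "suminf (\<lambda>j. a j n) = (\<Sum>j\<le>n. g j * deriv_coeff (n - j) / deriv_coeff (n - 1))" for n
    by (subst suminf_finite[of "{..n}"]) (auto simp: a_def)
  ultimately have "(\<lambda>n. real (root_rank_count K (Suc i)) *
      (\<Sum>j\<le>n. g j * deriv_coeff (n - j) / deriv_coeff (n - 1))) \<longlonglongrightarrow>
      real (root_rank_count K (Suc i)) * hole_limit i"
    using T by (intro tendsto_mult_left) simp
  moreover have "\<forall>\<^sub>F n in sequentially. real (root_rank_count K (Suc i)) *
      (\<Sum>j\<le>n. g j * deriv_coeff (n - j) / deriv_coeff (n - 1)) = rank_size_prob_in K n (Suc i)"
    using eventually_ge_at_top[of 1]
    by eventually_elim (simp add: rank_size_prob_in_eq g_def)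
  ultimately show ?thesis by (rule Lim_transform_eventually)
qed

subsection \<open>No loss of mass\<close>

text \<open>Summed over all trees, the derivatives of the series G give (1 - sin x) times a partial
  sum of y', and (1 - sin x) y' = 1. So \<open>H N\<close> grows with slope nearly 1 up to a point
  close to \<rho>, and \<open>H N \<rho> / \<rho>\<close> is nearly 1 or larger.\<close>

lemma hole_sum_ge:
  assumes "\<epsilon> > 0"
  shows "\<exists>N. 1 - \<epsilon> \<le> (\<Sum>i<N. real (tree_count (Suc i)) * hole_limit i)"
proof -
  define \<rho> :: real where "\<rho> = pi / 2"
  define H where "H N x = (\<Sum>i<N. real (tree_count (Suc i)) * eval_fps (hole_fps i) x)" for N x
  define DN where "DN N x = (\<Sum>i<N. deriv_coeff i * x ^ i)" for N and x :: real
  have \<rho>: "\<rho> > 0" by (simp add: \<rho>_def)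
  have H': "(H N has_real_derivative (1 - sin x) * DN N x) (at x)" for N x
  proof -
    have "(eval_fps (hole_fps i) has_real_derivative (1 - sin x) * (1 / fact i * x ^ i)) (at x)" for i
    proof -
      have c1: "fps_conv_radius (1 - fps_sin 1 :: real fps) = \<infinity>"
        using fps_conv_radius_diff[of "1 :: real fps" "fps_sin 1"] by simp
      have c2: "fps_conv_radius (fps_const (1 / fact i) * fps_X ^ i :: real fps) = \<infinity>"
        using fps_conv_radius_mult[of "fps_const (1 / fact i :: real)" "fps_X ^ i"] by simp
      have "eval_fps (fps_deriv (hole_fps i)) x = (1 - sin x) * (1 / fact i * x ^ i)"
        unfolding hole_fps_deriv using c1 c2 by (simp add: eval_fps_mult eval_fps_diff)
      then show ?thesis
        using has_field_derivative_eval_fps[of x "hole_fps i" UNIV] by (simp add: hole_fps_conv_radius)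
    qed
    then have "((\<lambda>x. \<Sum>i<N. real (tree_count (Suc i)) * eval_fps (hole_fps i) x) has_real_derivative
        (\<Sum>i<N. real (tree_count (Suc i)) * ((1 - sin x) * (1 / fact i * x ^ i)))) (at x)"
      by (intro DERIV_sum DERIV_cmult) auto
    then show ?thesis by (simp add: H_def[abs_def] DN_def sum_distrib_left mult_ac)
  qed
  have H0: "H N 0 = 0" for N by (simp add: H_def eval_fps_at_0 hole_fps_def)
  have DN_nonneg: "DN N x \<ge> 0" if "x \<ge> 0" for N x unfolding DN_def using that by (intro sum_nonneg) auto
  \<comment> \<open>Bridges the gap from \<open>x0\<close> to \<rho>, where y' has its pole and its
    partial sums are not uniformly close.\<close>
  have H_mono: "H N x \<le> H N y" if "0 \<le> x" "x \<le> y" for N x y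
  proof (rule DERIV_nonneg_imp_nondecreasing[OF that(2)])
    fix z assume "x \<le> z" "z \<le> y"
    then have "0 \<le> (1 - sin z) * DN N z" using \<open>0 \<le> x\<close> DN_nonneg[of z N] by simp
    then show "\<exists>d. (H N has_real_derivative d) (at z) \<and> 0 \<le> d" using H' by blast
  qed
  have summ: "summable (\<lambda>n. deriv_coeff n * x ^ n)" if x: "0 \<le> x" "x < \<rho>" for x
  proof -
    obtain C where upper: "\<And>n. deriv_coeff n \<le> C * real (Suc n) / \<rho> ^ n"
      using deriv_coeff_bounds unfolding \<rho>_def by blast
    have "summable (\<lambda>n. real (Suc n) * (x / \<rho>) ^ n)"
      using geometric_deriv_sums[of "x / \<rho>"] x \<rho> by (auto simp: sums_iff)
    then have dom: "summable (\<lambda>n. C * (real (Suc n) * (x / \<rho>) ^ n))" by (rule summable_mult)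
    have "norm (deriv_coeff n * x ^ n) \<le> C * (real (Suc n) * (x / \<rho>) ^ n)" for n
    proof -
      have "deriv_coeff n * x ^ n \<le> C * real (Suc n) / \<rho> ^ n * x ^ n"
        using upper[of n] x(1) by (intro mult_right_mono) auto
      then show ?thesis using x(1) by (simp add: power_divide abs_mult)
    qed
    then show ?thesis by (intro summable_comparison_test'[OF dom])
  qed
  have cr: "fps_conv_radius (fps_deriv tree_egf :: real fps) \<ge> \<rho>"
    unfolding fps_conv_radius_def
  proof (rule conv_radius_geI_ex)
    fix r :: real assume "0 < r" "ereal r < ereal \<rho>"
    then show "\<exists>z::real. norm z = r \<and> summable (\<lambda>n. fps_nth (fps_deriv tree_egf) n * z ^ n)"
      using summ[of r] unfolding deriv_coeff_eq by (intro exI[of _ r]) simp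
  qed
  have D_sums: "(\<lambda>n. deriv_coeff n * x ^ n) sums (1 / (1 - sin x))" if x: "0 \<le> x" "x < \<rho>" for x
  proof -
    have lt: "ereal (norm x) < fps_conv_radius (fps_deriv tree_egf :: real fps)"
      using cr x by (intro less_le_trans[OF _ cr]) simp
    have c1: "fps_conv_radius (1 - fps_sin 1 :: real fps) = \<infinity>"
      using fps_conv_radius_diff[of "1 :: real fps" "fps_sin 1"] by simp
    have "eval_fps (fps_deriv tree_egf * (1 - fps_sin 1)) x = eval_fps (fps_deriv tree_egf) x * (1 - sin x)"
      using lt c1 by (subst eval_fps_mult) (simp_all add: eval_fps_diff)
    then have "eval_fps (fps_deriv tree_egf) x * (1 - sin x) = 1"
      unfolding tree_egf_eq(1) by simp
    then have "eval_fps (fps_deriv tree_egf) x = 1 / (1 - sin x)"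
      by (metis nonzero_eq_divide_eq mult_zero_right zero_neq_one)
    then show ?thesis using sums_eval_fps[OF lt] by (simp only: deriv_coeff_eq)
  qed
  \<comment> \<open>One factor \<open>1 - \<delta>\<close> is lost in the slope and one in the
    length \<open>x0 / \<rho>\<close>, so \<open>2 * \<delta> \<le> \<epsilon>\<close> suffices; the
    cap \<open>1 / 2\<close> keeps \<open>x0\<close> positive.\<close>
  define \<delta> where "\<delta> = min (\<epsilon> / 2) (1 / 2)"
  have \<delta>: "0 < \<delta>" "\<delta> < 1" "2 * \<delta> \<le> \<epsilon>" using assms by (auto simp: \<delta>_def)
  define x0 where "x0 = \<rho> * (1 - \<delta>)"
  have x0: "0 < x0" "x0 < \<rho>" using \<delta> \<rho> by (auto simp: x0_def)
  \<comment> \<open>The coefficients are positive, so the tail at \<open>x0\<close> dominates the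
    tail at every \<open>x\<close> in [0, x0], and one \<open>N\<close> serves the whole
    interval.\<close>
  obtain N where tail0: "norm (\<Sum>i. deriv_coeff (i + N) * x0 ^ (i + N)) < \<delta>"
    using suminf_exist_split[OF \<delta>(1) summ[of x0]] x0 by auto
  have DN_ge: "1 - \<delta> \<le> (1 - sin x) * DN N x" if x: "0 \<le> x" "x \<le> x0" for x
  proof -
    have s: "sin x < 1"
    proof -
      have "sin x < sin (pi / 2)" using x x0 by (intro sin_monotone_2pi) (auto simp: \<rho>_def)
      then show ?thesis by simp
    qed
    have s0: "sin x \<ge> 0" using x x0 by (intro sin_ge_zero) (auto simp: \<rho>_def)
    have sx: "summable (\<lambda>n. deriv_coeff n * x ^ n)" using x x0 by (intro summ) auto
    have "1 / (1 - sin x) = (\<Sum>i. deriv_coeff (i + N) * x ^ (i + N)) + DN N x"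
      unfolding DN_def using suminf_split_initial_segment[OF sx, of N] D_sums[of x] x x0
      by (simp add: sums_iff)
    also have "(\<Sum>i. deriv_coeff (i + N) * x ^ (i + N)) \<le> (\<Sum>i. deriv_coeff (i + N) * x0 ^ (i + N))"
    proof (rule suminf_le)
      show "deriv_coeff (n + N) * x ^ (n + N) \<le> deriv_coeff (n + N) * x0 ^ (n + N)" for n
        using x by (intro mult_left_mono power_mono) auto
      show "summable (\<lambda>n. deriv_coeff (n + N) * x ^ (n + N))"
        using sx by (rule summable_ignore_initial_segment)
      show "summable (\<lambda>n. deriv_coeff (n + N) * x0 ^ (n + N))"
        using summ[of x0] x0 by (intro summable_ignore_initial_segment) auto
    qed
    also have "\<dots> \<le> \<delta>" using tail0 by simp
    finally have "1 / (1 - sin x) - \<delta> \<le> DN N x" by simp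
    then have "(1 - sin x) * (1 / (1 - sin x) - \<delta>) \<le> (1 - sin x) * DN N x"
      using s by (intro mult_left_mono) auto
    moreover have "(1 - sin x) * (1 / (1 - sin x) - \<delta>) = 1 - (1 - sin x) * \<delta>"
      using s by (simp add: right_diff_distrib)
    moreover have "(1 - sin x) * \<delta> \<le> 1 * \<delta>" using s0 \<delta> by (intro mult_right_mono) auto
    ultimately show ?thesis by linarith
  qed
  have "(1 - \<delta>) * x0 \<le> H N x0"
  proof -
    have "H N 0 - (1 - \<delta>) * 0 \<le> H N x0 - (1 - \<delta>) * x0"
    proof (rule DERIV_nonneg_imp_nondecreasing[where f = "\<lambda>x. H N x - (1 - \<delta>) * x"])
      fix x assume x: "0 \<le> x" "x \<le> x0"
      have "((\<lambda>x. H N x - (1 - \<delta>) * x) has_real_derivative (1 - sin x) * DN N x - (1 - \<delta>)) (at x)"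
        by (auto intro!: derivative_eq_intros H')
      then show "\<exists>y. ((\<lambda>x. H N x - (1 - \<delta>) * x) has_real_derivative y) (at x) \<and> 0 \<le> y"
        using DN_ge[OF x] by auto
    qed (use x0 in auto)
    then show ?thesis by (simp add: H0)
  qed
  also have "H N x0 \<le> H N \<rho>" using x0 by (intro H_mono) auto
  finally have "(1 - \<delta>) * x0 / \<rho> \<le> H N \<rho> / \<rho>" using \<rho> by (intro divide_right_mono) auto
  moreover have "(1 - \<delta>) * x0 / \<rho> = (1 - \<delta>) * (1 - \<delta>)" using \<rho> by (simp add: x0_def)
  moreover have "(1 - \<delta>) * (1 - \<delta>) \<ge> 1 - \<epsilon>"
  proof -
    have "(1 - \<delta>) * (1 - \<delta>) = 1 - 2 * \<delta> + \<delta> * \<delta>" by (simp add: algebra_simps)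
    then show ?thesis using \<delta>(3) zero_le_square[of \<delta>] by linarith
  qed
  moreover have "H N \<rho> / \<rho> = (\<Sum>i<N. real (tree_count (Suc i)) * hole_limit i)"
    by (simp add: H_def hole_limit_def \<rho>_def[symmetric] sum_divide_distrib)
  ultimately show ?thesis by (intro exI[of _ N]) linarith
qed

text \<open>Scheffe's argument: no mass of the probability vectors \<open>S n\<close> escapes to infinity.\<close>

lemma sum_tendsto_of_dominated:
  fixes S W :: "nat \<Rightarrow> nat \<Rightarrow> real"
  assumes S: "\<And>i. (\<lambda>n. S n i) \<longlonglongrightarrow> u i" and W: "\<And>i. (\<lambda>n. W n i) \<longlonglongrightarrow> w i"
    and W_nonneg: "\<And>n i. 0 \<le> W n i" and W_le: "\<And>n i. W n i \<le> S n i"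
    and total: "\<And>n. n \<ge> 1 \<Longrightarrow> (\<Sum>i<n. S n i) = 1"
    and mass: "\<And>\<epsilon>. \<epsilon> > 0 \<Longrightarrow> \<exists>N. 1 - \<epsilon> \<le> (\<Sum>i<N. u i)"
  shows "summable w" "(\<lambda>n. \<Sum>i<n. W n i) \<longlonglongrightarrow> suminf w"
proof -
  have S_nonneg: "0 \<le> S n i" for n i using W_nonneg[of n i] W_le[of n i] by linarith
  have u_nonneg: "0 \<le> u i" for i by (rule LIMSEQ_le_const[OF S]) (use S_nonneg in blast)
  have w_nonneg: "0 \<le> w i" for i by (rule LIMSEQ_le_const[OF W]) (use W_nonneg in blast)
  have w_le: "w i \<le> u i" for i by (rule LIMSEQ_le[OF W S]) (use W_le in blast)
  \<comment> \<open>Every head of length \<open>N\<close> of \<open>S n\<close> is at most 1 once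
    \<open>n \<ge> max 1 N\<close>, and this passes to the limit.\<close>
  have u_sum: "(\<Sum>i<N. u i) \<le> 1" for N
  proof (rule LIMSEQ_le_const2)
    show "(\<lambda>n. \<Sum>i<N. S n i) \<longlonglongrightarrow> (\<Sum>i<N. u i)" by (intro tendsto_sum S)
    have "(\<Sum>i<N. S n i) \<le> 1" if "n \<ge> max 1 N" for n
    proof -
      have "(\<Sum>i<N. S n i) \<le> (\<Sum>i<n. S n i)" using that S_nonneg by (intro sum_mono2) auto
      then show ?thesis using total[of n] that by simp
    qed
    then show "\<exists>M. \<forall>n\<ge>M. (\<Sum>i<N. S n i) \<le> 1" by blast
  qed
  have u: "summable u" by (rule summableI_nonneg_bounded[OF u_nonneg u_sum])
  show w: "summable w" by (rule summable_comparison_test'[OF u]) (use w_nonneg w_le in auto)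
  show "(\<lambda>n. \<Sum>i<n. W n i) \<longlonglongrightarrow> suminf w"
  proof (rule LIMSEQ_I)
    fix r :: real assume "r > 0"
    \<comment> \<open>For large \<open>n\<close> the tail of \<open>S n\<close> beyond
      \<open>N\<close>, hence that of \<open>W n\<close>, is below 2\<epsilon>: its complement is
      within \<epsilon> of a sum that is at least 1 - \<epsilon>. The heads of \<open>W n\<close>
      and \<open>w\<close> differ by less than \<epsilon>, and the tail of \<open>w\<close> is at
      most \<epsilon>.\<close>
    define \<epsilon> where "\<epsilon> = r / 4"
    have \<epsilon>: "\<epsilon> > 0" using \<open>r > 0\<close> by (simp add: \<epsilon>_def)
    obtain N where N: "1 - \<epsilon> \<le> (\<Sum>i<N. u i)" using mass[OF \<epsilon>] by blast
    have tail: "suminf w - (\<Sum>i<N. w i) \<le> \<epsilon>" "(\<Sum>i<N. w i) \<le> suminf w"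
    proof -
      have "(\<Sum>i. w (i + N)) \<le> (\<Sum>i. u (i + N))"
        by (intro suminf_le w_le summable_ignore_initial_segment u w)
      moreover have "suminf w = (\<Sum>i. w (i + N)) + (\<Sum>i<N. w i)"
        by (rule suminf_split_initial_segment[OF w])
      moreover have "suminf u = (\<Sum>i. u (i + N)) + (\<Sum>i<N. u i)"
        by (rule suminf_split_initial_segment[OF u])
      moreover have "suminf u \<le> 1" by (rule suminf_le_const[OF u u_sum])
      ultimately show "suminf w - (\<Sum>i<N. w i) \<le> \<epsilon>" using N by linarith
      show "(\<Sum>i<N. w i) \<le> suminf w" by (rule sum_le_suminf[OF w]) (use w_nonneg in auto)
    qed
    have "(\<lambda>n. \<Sum>i<N. W n i) \<longlonglongrightarrow> (\<Sum>i<N. w i)" by (intro tendsto_sum W)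
    then obtain n1 where n1: "\<And>n. n \<ge> n1 \<Longrightarrow> norm ((\<Sum>i<N. W n i) - (\<Sum>i<N. w i)) < \<epsilon>"
      using LIMSEQ_D[OF _ \<epsilon>] by blast
    have "(\<lambda>n. \<Sum>i<N. S n i) \<longlonglongrightarrow> (\<Sum>i<N. u i)" by (intro tendsto_sum S)
    then obtain n2 where n2: "\<And>n. n \<ge> n2 \<Longrightarrow> norm ((\<Sum>i<N. S n i) - (\<Sum>i<N. u i)) < \<epsilon>"
      using LIMSEQ_D[OF _ \<epsilon>] by blast
    have "norm ((\<Sum>i<n. W n i) - suminf w) < r" if n: "n \<ge> Max {1, N, n1, n2}" for n
    proof -
      have split: "(\<Sum>i<n. f i) = (\<Sum>i<N. f i) + (\<Sum>i=N..<n. f i)" for f :: "nat \<Rightarrow> real"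
        using n sum.atLeastLessThan_concat[of 0 N n f] by (simp add: lessThan_atLeast0)
      have "(\<Sum>i=N..<n. W n i) \<le> (\<Sum>i=N..<n. S n i)" by (intro sum_mono W_le)
      moreover have "(\<Sum>i=N..<n. W n i) \<ge> 0" by (intro sum_nonneg W_nonneg)
      moreover have "(\<Sum>i<N. S n i) + (\<Sum>i=N..<n. S n i) = 1" using total[of n] n split[of "S n"] by simp
      moreover have "\<bar>(\<Sum>i<N. W n i) - (\<Sum>i<N. w i)\<bar> < \<epsilon>" using n1[of n] n by simp
      moreover have "\<bar>(\<Sum>i<N. S n i) - (\<Sum>i<N. u i)\<bar> < \<epsilon>" using n2[of n] n by simp
      ultimately have "\<bar>(\<Sum>i<N. W n i) + (\<Sum>i=N..<n. W n i) - suminf w\<bar> < 4 * \<epsilon>"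
        using tail N by linarith
      then show ?thesis by (simp add: split \<epsilon>_def)
    qed
    then show "\<exists>no. \<forall>n\<ge>no. norm ((\<Sum>i<n. W n i) - suminf w) < r" by blast
  qed
qed

section \<open>Comparison of a single rank with all ranks\<close>

lemma rank_size_prob_in_nonneg: "rank_size_prob_in K n i \<ge> 0"
  by (simp add: rank_size_prob_in_def)

lemma rank_size_prob_in_mono:
  assumes "K \<subseteq> L"
  shows "rank_size_prob_in K n i \<le> rank_size_prob_in L n i"
proof -
  have "pair_count K i n \<le> pair_count L i n"
    unfolding pair_count_def count_vertices_def using assms by (intro sum_mono card_mono) auto
  then show ?thesis unfolding rank_size_prob_in_def by (intro divide_right_mono) auto
qed

theorem theorem2p13:
  fixes k :: nat
  assumes "k \<ge> 1"
  shows "(\<forall>i\<ge>1. convergent (\<lambda>n. rank_size_prob k n i)) \<and>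
    summable (\<lambda>i. limit_rank_size_prob k (Suc i)) \<and>
    (\<lambda>n. rank_prob k n) \<longlonglongrightarrow> (\<Sum>i. limit_rank_size_prob k (Suc i))"
proof -
  define w where "w i = real (root_rank_count {k} (Suc i)) * hole_limit i" for i
  have eq: "rank_size_prob k n i = rank_size_prob_in {k} n i" if "n \<ge> 1" for n i
    using prob_rank_size[OF that, of "{k}" i] by (simp add: rank_size_prob_def)
  have lim: "(\<lambda>n. rank_size_prob k n (Suc i)) \<longlonglongrightarrow> w i" for i
  proof (rule Lim_transform_eventually)
    show "(\<lambda>n. rank_size_prob_in {k} n (Suc i)) \<longlonglongrightarrow> w i"
      unfolding w_def by (rule rank_size_prob_in_tendsto)
    show "\<forall>\<^sub>F n in sequentially. rank_size_prob_in {k} n (Suc i) = rank_size_prob k n (Suc i)"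
      using eventually_ge_at_top[of 1] by eventually_elim (simp add: eq)
  qed
  have w: "limit_rank_size_prob k (Suc i) = w i" for i
    unfolding limit_rank_size_prob_def by (rule limI[OF lim])
  \<comment> \<open>With \<open>K = UNIV\<close> the rank condition is void, so the size
    probabilities add up to 1; they dominate those for \<open>{k}\<close>.\<close>
  have total: "(\<Sum>i<n. rank_size_prob_in UNIV n (Suc i)) = 1" if "n \<ge> 1" for n
    using prob_rank[OF that, of UNIV] by simp
  have mass: "\<exists>N. 1 - \<epsilon> \<le> (\<Sum>i<N. real (root_rank_count UNIV (Suc i)) * hole_limit i)"
    if "\<epsilon> > 0" for \<epsilon>
    using hole_sum_ge[OF that] by (simp add: root_rank_count_UNIV)
  note main = sum_tendsto_of_dominated[OF rank_size_prob_in_tendsto[of UNIV]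
      rank_size_prob_in_tendsto[of "{k}"] rank_size_prob_in_nonneg
      rank_size_prob_in_mono[OF subset_UNIV] total mass]
  have "summable w" unfolding w_def by (rule main(1))
  moreover have "(\<lambda>n. rank_prob k n) \<longlonglongrightarrow> suminf w"
  proof (rule Lim_transform_eventually)
    show "(\<lambda>n. \<Sum>i<n. rank_size_prob_in {k} n (Suc i)) \<longlonglongrightarrow> suminf w"
      unfolding w_def by (rule main(2))
    show "\<forall>\<^sub>F n in sequentially. (\<Sum>i<n. rank_size_prob_in {k} n (Suc i)) = rank_prob k n"
      using eventually_ge_at_top[of 1]
      by eventually_elim (use prob_rank[of _ "{k}"] in \<open>simp add: rank_prob_def\<close>)
  qed
  moreover have "convergent (\<lambda>n. rank_size_prob k n i)" if "i \<ge> 1" for i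
    using lim[of "i - 1"] that by (auto simp: convergent_def)
  ultimately show ?thesis by (simp add: w)
qed

end
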